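(* Let $B$ be an $(n_c,n_v)$-regular $n_cN_1\times n_vN_1$ parity-check matrix of a protograph-based QC-LDPC code (from the $n_c\times n_v$ all-one protograph) of girth $6$. Then, for each desired value $g\in\{14,16,18\}$, there exists a lifting factor $N$ for which $B$ can be lifted to obtain a QC-LDPC code with parity-check matrix $H_{n_c}$ of girth $g$.
   Context: $B$ is an $n_c\times n_v$ array of $N_1\times N_1$ circulant permutation matrices (so it has column weight $n_c$ and row weight $n_v$). A lifting of $B$ with lifting factor $N$ is a matrix obtained by replacing each entry $1$ of $B$ by some $N\times N$ circulant permutation matrix and each entry $0$ by the $N\times N$ zero matrix. The Tanner graph of a $0/1$ matrix is the bipartite graph with one check node per row, one variable node per column, and an edge for each entry equal to $1$; the girth of a matrix (or of the code given by that parity-check matrix) is the length of a shortest cycle in its Tanner graph. *)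

theory Defs
  imports "Jordan_Normal_Form.Matrix" "HOL-Library.Z2" "HOL-Library.Extended_Nat"
begin

type_synonym 'v ugraph = "'v set \<times> 'v set set"

text \<open>A cycle is given by its vertices in cyclic order, without repeating the first one at the
  end; its length as a list is the number of its edges.\<close>

definition is_cycle :: "'v ugraph \<Rightarrow> 'v list \<Rightarrow> bool" where
  "is_cycle G p \<longleftrightarrow> 3 \<le> length p \<and> distinct p \<and> set p \<subseteq> fst G \<and>
     (\<forall>i<length p. {p ! i, p ! (Suc i mod length p)} \<in> snd G)"

text \<open>The girth of a graph without cycles is \<open>\<infinity>\<close>.\<close>

definition graph_girth :: "'v ugraph \<Rightarrow> enat" where
  "graph_girth G = (INF p\<in>{p. is_cycle G p}. enat (length p))"

text \<open>Matrices are over the two-element field; rows are check nodes \<open>Inl i\<close>, columns are variable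
  nodes \<open>Inr j\<close>.\<close>

definition tanner_graph :: "bit mat \<Rightarrow> (nat + nat) ugraph" where
  "tanner_graph H =
     (Inl ` {..<dim_row H} \<union> Inr ` {..<dim_col H},
      {{Inl i, Inr j} | i j. i < dim_row H \<and> j < dim_col H \<and> H $$ (i, j) = 1})"

definition mat_girth :: "bit mat \<Rightarrow> enat" where
  "mat_girth H = graph_girth (tanner_graph H)"

definition regular_mat :: "nat \<Rightarrow> nat \<Rightarrow> bit mat \<Rightarrow> bool" where
  "regular_mat c r H \<longleftrightarrow>
     (\<forall>j<dim_col H. card {i. i < dim_row H \<and> H $$ (i, j) = 1} = c) \<and>
     (\<forall>i<dim_row H. card {j. j < dim_col H \<and> H $$ (i, j) = 1} = r)"

definition circulant :: "nat \<Rightarrow> bit mat \<Rightarrow> bool" where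
  "circulant N A \<longleftrightarrow> A \<in> carrier_mat N N \<and>
     (\<forall>i<N. \<forall>j<N. A $$ (Suc i mod N, Suc j mod N) = A $$ (i, j))"

definition permutation_matrix :: "nat \<Rightarrow> bit mat \<Rightarrow> bool" where
  "permutation_matrix N A \<longleftrightarrow> A \<in> carrier_mat N N \<and>
     (\<forall>i<N. \<exists>!j. j < N \<and> A $$ (i, j) = 1) \<and> (\<forall>j<N. \<exists>!i. i < N \<and> A $$ (i, j) = 1)"

definition circulant_permutation_matrix :: "nat \<Rightarrow> bit mat \<Rightarrow> bool" where
  "circulant_permutation_matrix N A \<longleftrightarrow> circulant N A \<and> permutation_matrix N A"

definition block :: "nat \<Rightarrow> bit mat \<Rightarrow> nat \<Rightarrow> nat \<Rightarrow> bit mat" where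
  "block N H a b = mat N N (\<lambda>(i, j). H $$ (a * N + i, b * N + j))"

definition is_lifting :: "nat \<Rightarrow> bit mat \<Rightarrow> bit mat \<Rightarrow> bool" where
  "is_lifting N B H \<longleftrightarrow> 0 < N \<and> H \<in> carrier_mat (dim_row B * N) (dim_col B * N) \<and>
     (\<forall>a<dim_row B. \<forall>b<dim_col B.
        if B $$ (a, b) = 1 then circulant_permutation_matrix N (block N H a b)
        else block N H a b = 0\<^sub>m N N)"

definition quasi_cyclic :: "nat \<Rightarrow> bit mat \<Rightarrow> bool" where
  "quasi_cyclic N H \<longleftrightarrow> 0 < N \<and> N dvd dim_row H \<and> N dvd dim_col H \<and>
     (\<forall>a<dim_row H div N. \<forall>b<dim_col H div N. circulant N (block N H a b))"

definition all_one_mat :: "nat \<Rightarrow> nat \<Rightarrow> bit mat" where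
  "all_one_mat m n = mat m n (\<lambda>_. 1)"

lemma is_lifting_quasi_cyclic:
  assumes "is_lifting N B H"
  shows "quasi_cyclic N H"
proof -
  have blocks: "if B $$ (a, b) = 1 then circulant_permutation_matrix N (block N H a b)
      else block N H a b = 0\<^sub>m N N" if "a < dim_row B" "b < dim_col B" for a b
    using assms that unfolding is_lifting_def by blast
  have zero: "circulant N (0\<^sub>m N N)"
    unfolding circulant_def by simp
  have circ: "circulant N (block N H a b)" if "a < dim_row B" "b < dim_col B" for a b
    using blocks[OF that] zero by (simp add: circulant_permutation_matrix_def split: if_splits)
  have N: "0 < N" and dims: "dim_row H = dim_row B * N" "dim_col H = dim_col B * N"
    using assms unfolding is_lifting_def by blast+
  show ?thesis
    unfolding quasi_cyclic_def dims using N circ by simp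
qed

lemma card_block_decomp:
  fixes P :: "nat \<Rightarrow> bool"
  assumes "0 < N" and "\<And>a. a < m \<Longrightarrow> \<exists>!i. i < N \<and> P (a * N + i)"
  shows "card {k. k < m * N \<and> P k} = m"
proof -
  have "bij_betw (\<lambda>k. k div N) {k. k < m * N \<and> P k} {..<m}"
  proof (rule bij_betw_imageI)
    show "inj_on (\<lambda>k. k div N) {k. k < m * N \<and> P k}"
    proof (rule inj_onI)
      fix x y
      assume x: "x \<in> {k. k < m * N \<and> P k}" and y: "y \<in> {k. k < m * N \<and> P k}"
        and eq: "x div N = y div N"
      have "x div N < m"
        using x by (simp add: less_mult_imp_div_less)
      then have "\<exists>!i. i < N \<and> P (x div N * N + i)"
        by (rule assms(2))
      moreover have "x mod N < N \<and> P (x div N * N + x mod N)"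
        using x assms(1) by simp
      moreover have "y mod N < N \<and> P (x div N * N + y mod N)"
        using y assms(1) unfolding eq by simp
      ultimately have "x mod N = y mod N"
        by blast
      with eq show "x = y"
        by (metis div_mult_mod_eq)
    qed
    show "(\<lambda>k. k div N) ` {k. k < m * N \<and> P k} = {..<m}"
    proof (intro equalityI subsetI)
      fix a
      assume "a \<in> {..<m}"
      then have a: "a < m"
        by simp
      obtain i where i: "i < N" "P (a * N + i)"
        using assms(2)[OF a] by blast
      have "a * N + i < Suc a * N"
        using i by simp
      also have "\<dots> \<le> m * N"
        using a by (intro mult_le_mono1) simp
      finally have "a * N + i \<in> {k. k < m * N \<and> P k}"
        using i by simp
      moreover have "(a * N + i) div N = a"
        using i by simp
      ultimately show "a \<in> (\<lambda>k. k div N) ` {k. k < m * N \<and> P k}"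
        by (intro rev_image_eqI) (simp, rule sym)
    qed (auto simp: less_mult_imp_div_less)
  qed
  then show ?thesis
    by (metis bij_betw_same_card card_lessThan)
qed

lemma lifting_all_one_regular:
  assumes "is_lifting N (all_one_mat m n) H"
  shows "regular_mat m n H"
proof -
  have N: "0 < N" and dims: "dim_row H = m * N" "dim_col H = n * N"
    using assms by (auto simp: is_lifting_def all_one_mat_def)
  have perm: "permutation_matrix N (block N H a b)" if "a < m" "b < n" for a b
    using assms that
    by (auto simp: is_lifting_def all_one_mat_def circulant_permutation_matrix_def)
  have "card {i. i < m * N \<and> H $$ (i, j) = 1} = m" if j: "j < n * N" for j
  proof (rule card_block_decomp[OF N])
    fix a
    assume "a < m"
    moreover have "j div N < n"
      using j by (simp add: less_mult_imp_div_less)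
    ultimately have "permutation_matrix N (block N H a (j div N))"
      by (rule perm)
    then have "\<exists>!i. i < N \<and> block N H a (j div N) $$ (i, j mod N) = 1"
      using N by (auto simp: permutation_matrix_def)
    then show "\<exists>!i. i < N \<and> H $$ (a * N + i, j) = 1"
      using N by (simp add: block_def cong: conj_cong)
  qed
  moreover have "card {j. j < n * N \<and> H $$ (i, j) = 1} = n" if i: "i < m * N" for i
  proof (rule card_block_decomp[OF N])
    fix b
    assume "b < n"
    moreover have "i div N < m"
      using i by (simp add: less_mult_imp_div_less)
    ultimately have "permutation_matrix N (block N H (i div N) b)"
      by (intro perm)
    then have "\<exists>!j. j < N \<and> block N H (i div N) b $$ (i mod N, j) = 1"
      using N by (auto simp: permutation_matrix_def)
    then show "\<exists>!j. j < N \<and> H $$ (i, b * N + j) = 1"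
      using N by (simp add: block_def cong: conj_cong)
  qed
  ultimately show ?thesis
    by (simp add: regular_mat_def dims)
qed

end

theory Submission
  imports Defs
begin

text \<open>
  A lifting by circulant permutation matrices assigns to each edge of the Tanner graph a voltage in
  \<open>\<int>/N\<close>, and cycles of the lifted graph project to cyclically reduced closed walks of total voltage \<open>0\<close>.
  Such a walk either uses some edge unequally often in both directions, or traverses every edge
  of its support both ways. In the latter case its support has a vertex of degree at least \<open>3\<close>, and
  absence of \<open>4\<close>-cycles gives nine different edges around this vertex; hence the length is at
  least \<open>18\<close>. Given a cycle \<open>D\<close> of the base graph and \<open>m\<close> with \<open>m |D| \<le> 18\<close>, choose the voltages
  generic except that \<open>D\<close> has voltage of order \<open>m\<close>. Then every shorter closed walk of voltage \<open>0\<close>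
  has edge counts a multiple of \<open>m\<close> times those of \<open>D\<close>, which is absurd, while \<open>D\<close> repeated \<open>m\<close> times
  lifts to a cycle. So the girth is exactly \<open>m |D|\<close>.

  It remains to find such cycles. The \<open>6\<close>-cycle, tripled, gives \<open>18\<close>. Its translates in \<open>B\<close> are
  hexagons indexed by \<open>k \<in> \<int>/N\<^sub>1\<close>, and two chords of the hexagon join translate \<open>k\<close>
  to the translates \<open>k + x\<close> and \<open>k + y\<close>. Running around the commutator square \<open>0, x, x + y, y\<close> gives a
  \<open>14\<close>-cycle, and also a \<open>16\<close>-cycle unless \<open>x = y\<close>, when there is an \<open>8\<close>-cycle, which is doubled.
\<close>

section \<open>Closed walks and cycles\<close>

text \<open>Around a vertex with three neighbours in the support, two more steps from each neighbour
  give nine edges. Each is used in both directions, so one period has at least 18 steps. Without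
  such a vertex the support has no branching, and a walk that covers its edges both ways would have
  to backtrack.\<close>

lemma balanced_walk_length:
  fixes w :: "int \<Rightarrow> 'v" and L :: nat and A :: "'v \<Rightarrow> 'v \<Rightarrow> bool"
  assumes L: "0 < L"
    and per: "\<And>i. w (i + int L) = w i"
    and color: "\<And>i. color (w (i + 1)) \<longleftrightarrow> \<not> color (w i)"
    and nb: "\<And>i. w (i + 2) \<noteq> w i"
    and adj: "\<And>i. A (w i) (w (i + 1))"
    and sym: "\<And>x y. A x y \<Longrightarrow> A y x"
    and no4: "\<And>a b c d. A a b \<Longrightarrow> A b c \<Longrightarrow> A c d \<Longrightarrow> A d a \<Longrightarrow> a \<noteq> c \<Longrightarrow> b \<noteq> d \<Longrightarrow> False"
    and bal: "\<And>i. \<exists>j. w j = w (i + 1) \<and> w (j + 1) = w i"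
  shows "18 \<le> L"
proof -
  have perk: "w (i + int L * k) = w i" for i k
  proof -
    have pos: "w (i + int L * int n) = w i" for i n
    proof (induction n)
      case (Suc n)
      have "i + int L * int (Suc n) = (i + int L * int n) + int L" by (simp add: algebra_simps)
      then show ?case using per[of "i + int L * int n"] Suc by metis
    qed simp
    show ?thesis
    proof (cases "0 \<le> k")
      case True then show ?thesis using pos[of i "nat k"] by simp
    next
      case False then show ?thesis using pos[of "i + int L * k" "nat (- k)"] by simp
    qed
  qed
  \<comment> \<open>The directed edges used by the walk. One period produces all of them, so there
    are at most \<open>L\<close>.\<close>
  define S where "S = (\<lambda>i. (w i, w (i + 1))) ` UNIV"
  have "S \<subseteq> (\<lambda>i. (w i, w (i + 1))) ` {0..<int L}"
  proof
    fix z assume "z \<in> S"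
    then obtain i where z: "z = (w i, w (i + 1))" by (auto simp: S_def)
    have "i = i mod int L + int L * (i div int L)" by simp
    moreover have "i + 1 = (i mod int L + 1) + int L * (i div int L)" by simp
    ultimately have "w i = w (i mod int L)" "w (i + 1) = w (i mod int L + 1)"
      using perk by metis+
    then show "z \<in> (\<lambda>i. (w i, w (i + 1))) ` {0..<int L}"
      using z L by auto
  qed
  then have fin: "finite S" and card: "card S \<le> L"
    using card_image_le[of "{0..<int L}" "\<lambda>i. (w i, w (i + 1))"]
      card_mono[of "(\<lambda>i. (w i, w (i + 1))) ` {0..<int L}" S]
    by (auto intro: finite_subset)
  have swap: "(y, x) \<in> S" if "(x, y) \<in> S" for x y
  proof -
    obtain i where "x = w i" "y = w (i + 1)" using \<open>(x, y) \<in> S\<close> by (auto simp: S_def)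
    then obtain j where "y = w j" "x = w (j + 1)" using bal[of i] by metis
    then show ?thesis by (auto simp: S_def)
  qed
  have SA: "A x y" if "(x, y) \<in> S" for x y
    using that adj by (auto simp: S_def)
  have Sc: "color y \<longleftrightarrow> \<not> color x" if "(x, y) \<in> S" for x y
    using that color by (auto simp: S_def)
  \<comment> \<open>After stepping from \<open>c\<close> to \<open>n\<close> the walk itself
    supplies two more steps, and \<open>nb\<close> keeps both from backtracking.\<close>
  have ext: "\<exists>m k. (n, m) \<in> S \<and> (m, k) \<in> S \<and> m \<noteq> c \<and> k \<noteq> n" if "(c, n) \<in> S" for c n
  proof -
    obtain j where j: "c = w j" "n = w (j + 1)" using \<open>(c, n) \<in> S\<close> unfolding S_def by blast
    have "(n, w (j + 2)) \<in> S" "(w (j + 2), w (j + 3)) \<in> S"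
      unfolding S_def j using image_eqI[of _ "\<lambda>i. (w i, w (i + 1))" "j + 1" UNIV]
        image_eqI[of _ "\<lambda>i. (w i, w (i + 1))" "j + 2" UNIV] by (simp_all add: add.assoc)
    moreover have "w (j + 3) \<noteq> n" using nb[of "j + 1"] j by (simp add: add.assoc)
    ultimately show ?thesis using nb[of j] j by blast
  qed
  show ?thesis
  proof (cases "\<exists>i z. (w i, z) \<in> S \<and> z \<noteq> w (i + 1) \<and> z \<noteq> w (i - 1)")
    case True
    then obtain i n3 where n3: "(w i, n3) \<in> S" "n3 \<noteq> w (i + 1)" "n3 \<noteq> w (i - 1)" by blast
    define c n1 n2 where defs: "c = w i" "n1 = w (i + 1)" "n2 = w (i - 1)"
    have n1: "(c, n1) \<in> S" by (auto simp: defs S_def)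
    have "(w (i - 1), w i) \<in> S" by (auto simp: S_def intro!: image_eqI[of _ _ "i - 1"])
    then have n2: "(c, n2) \<in> S" using swap by (auto simp: defs)
    have n: "n1 \<noteq> n2" "n1 \<noteq> n3" "n2 \<noteq> n3" using nb[of "i - 1"] n3 by (auto simp: defs add.commute[of 1])
    have n3': "(c, n3) \<in> S" using n3 by (simp add: defs)
    obtain m1 k1 where 1: "(n1, m1) \<in> S" "(m1, k1) \<in> S" "m1 \<noteq> c" "k1 \<noteq> n1" using ext[OF n1] by blast
    obtain m2 k2 where 2: "(n2, m2) \<in> S" "(m2, k2) \<in> S" "m2 \<noteq> c" "k2 \<noteq> n2" using ext[OF n2] by blast
    obtain m3 k3 where 3: "(n3, m3) \<in> S" "(m3, k3) \<in> S" "m3 \<noteq> c" "k3 \<noteq> n3" using ext[OF n3'] by blast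
    \<comment> \<open>A common second vertex \<open>m\<close> would close the 4-cycle
      \<open>c\<close>, \<open>x\<close>, \<open>m\<close>, \<open>y\<close>.\<close>
    have m: "m \<noteq> m'" if "(c, x) \<in> S" "(c, y) \<in> S" "x \<noteq> y" "(x, m) \<in> S" "(y, m') \<in> S" "m \<noteq> c"
      for m m' x y
      using no4[of c x m y] that SA sym by blast
    have md: "m1 \<noteq> m2" "m1 \<noteq> m3" "m2 \<noteq> m3"
      using m n1 n2 n3' n 1 2 3 by blast+
    have cols: "color n1 = (\<not> color c)" "color n2 = (\<not> color c)" "color n3 = (\<not> color c)"
      "color m1 = color c" "color m2 = color c" "color m3 = color c"
      "color k1 = (\<not> color c)" "color k2 = (\<not> color c)" "color k3 = (\<not> color c)"
      using n1 n2 n3' 1 2 3 Sc by blast+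
    have diff: "x \<noteq> y" if "x \<in> {c, m1, m2, m3}" "y \<in> {n1, n2, n3, k1, k2, k3}" for x y
      using that cols by auto
    have "\<forall>x\<in>{c, m1, m2, m3}. \<forall>y\<in>{n1, n2, n3, k1, k2, k3}. x \<noteq> y \<and> y \<noteq> x"
      using diff by metis
    note ineq = this[simplified]
    \<comment> \<open>Edges at \<open>c\<close> avoid \<open>m1\<close>, \<open>m2\<close>,
      \<open>m3\<close>. The other six are told apart by which of these they contain and by
      \<open>k1 \<noteq> n1\<close> and its analogues. Colours and the same inequalities separate
      the reversed pairs from the original ones.\<close>
    let ?T = "[(c, n1), (c, n2), (c, n3), (n1, m1), (n2, m2), (n3, m3), (m1, k1), (m2, k2), (m3, k3)]"
    let ?T' = "?T @ map prod.swap ?T"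
    have "distinct ?T'"
      using ineq n md 1(3,4) 2(3,4) 3(3,4) by simp
    moreover have "set ?T' \<subseteq> S" using n1 n2 n3' 1 2 3 swap by simp
    ultimately have "length ?T' \<le> card S"
      using card_mono[OF fin, of "set ?T'"] distinct_card[of ?T'] by metis
    then show ?thesis using card by simp
  next
    case False
    obtain j where j: "w j = w 1" "w (j + 1) = w 0" using bal[of 0] by auto
    txt \<open>All degrees are \<open>2\<close>, so the walk retraces itself backwards once it reuses an edge in the
      opposite direction, and it has to turn around at the fixed point of \<open>j + 1 + t \<mapsto> - t\<close>.\<close>
    have refl: "w (j + 1 + int t) = w (- int t) \<and> w (j + int t) = w (1 - int t)" for t
    proof (induction t)
      case 0 then show ?case using j by simp
    next
      case (Suc t)
      have "(w (j + 1 + int t), w (j + 1 + int t + 1)) \<in> S" by (auto simp: S_def)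
      then have "w (j + 1 + int t + 1) \<in> {w (- int t + 1), w (- int t - 1)}"
        using False Suc by (metis insert_iff)
      moreover have "w (j + 1 + int t + 1) \<noteq> w (- int t + 1)"
        using nb[of "j + int t"] Suc by (simp add: algebra_simps)
      ultimately have "w (j + 1 + int t + 1) = w (- int t - 1)" by simp
      moreover have "j + 1 + int t + 1 = j + 1 + int (Suc t)" "- int t - 1 = - int (Suc t)"
        "j + int (Suc t) = j + 1 + int t" "1 - int (Suc t) = - int t" by simp_all
      ultimately show ?case using Suc by metis
    qed
    have colk: "color (w (int n)) \<longleftrightarrow> (color (w 0) \<longleftrightarrow> even n)" for n
    proof (induction n)
      case (Suc n)
      show ?case using color[of "int n"] Suc by (simp add: add.commute[of 1])
    qed simp
    have colk': "color (w (- int n)) \<longleftrightarrow> (color (w 0) \<longleftrightarrow> even n)" for n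
    proof (induction n)
      case (Suc n)
      have eq: "- int (Suc n) = - int n - 1" by simp
      show ?case unfolding eq using color[of "- int n - 1"] Suc by auto
    qed simp
    \<comment> \<open>Colours alternate and \<open>w (j + 1) = w 0\<close>, so the reflection
      \<open>i \<mapsto> j + 1 - i\<close> fixes an integer \<open>h\<close>.\<close>
    have "even (j + 1)"
      using j(2) colk[of "nat (j + 1)"] colk'[of "nat (- (j + 1))"]
      by (cases "0 \<le> j + 1") (auto simp: even_nat_iff add.commute[of 1])
    then obtain h where h: "j + 1 = 2 * h" by blast
    \<comment> \<open>\<open>refl\<close> is available for nonnegative \<open>t\<close> only, so a
      multiple of the period is added to \<open>- h\<close>. At \<open>Suc t\<close> it then
      compares the two neighbours of position \<open>h\<close>.\<close>
    define t where "t = nat (int L * \<bar>h\<bar> - h)"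
    have "1 * \<bar>h\<bar> \<le> int L * \<bar>h\<bar>" using L by (intro mult_right_mono) auto
    then have "h \<le> int L * \<bar>h\<bar>" by linarith
    then have t: "int t = int L * \<bar>h\<bar> - h" unfolding t_def by (simp only: int_nat_eq if_True diff_ge_0_iff_ge)
    have "w (j + 1 + int (Suc t)) = w (- int (Suc t))" using refl by blast
    moreover have "j + 1 + int (Suc t) = h + 1 + int L * \<bar>h\<bar>" using t h by simp
    moreover have "- int (Suc t) = h - 1 + int L * (- \<bar>h\<bar>)" using t by simp
    ultimately have "w (h + 1) = w (h - 1)" by (metis perk)
    then show ?thesis using nb[of "h - 1"] by (simp add: add.commute[of 1])
  qed
qed

text \<open>Modulo \<open>K\<close> only the lowest coefficient remains, and it is too small to be a
  nonzero multiple of \<open>K\<close>. Dividing by \<open>K\<close> leaves a shorter sum.\<close>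

lemma digits_eq_0:
  fixes c :: "nat \<Rightarrow> int" and K :: int
  assumes "(\<Sum>i<n. c i * K ^ i) = 0" and "\<And>i. i < n \<Longrightarrow> \<bar>c i\<bar> < K"
  shows "i < n \<Longrightarrow> c i = 0"
  using assms
proof (induction n arbitrary: c i)
  case (Suc n)
  have sum: "(\<Sum>i<Suc n. c i * K ^ i) = c 0 + K * (\<Sum>i<n. c (Suc i) * K ^ i)"
    by (subst sum.lessThan_Suc_shift) (simp add: sum_distrib_left algebra_simps)
  have "K dvd c 0"
    using Suc.prems(2) unfolding sum by (metis dvd_add_times_triv_right_iff dvd_0_right mult.commute)
  then have c0: "c 0 = 0"
    using Suc.prems(3)[of 0] by (metis zdvd_not_zless zero_less_abs_iff dvd_abs_iff zero_less_Suc)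
  have "(\<Sum>i<n. c (Suc i) * K ^ i) = 0"
    using Suc.prems(2) Suc.prems(3)[of 0] c0 unfolding sum by auto
  then have "c (Suc j) = 0" if "j < n" for j
    using Suc.IH[of j "\<lambda>i. c (Suc i)"] Suc.prems(3) that by auto
  then show ?case using c0 Suc.prems(1) by (cases i) auto
qed simp

text \<open>Appending the head replaces the wrap-around index by consecutive list entries, so that
  explicit cycles can be checked by simplification.\<close>

lemma is_cycleI:
  assumes "3 \<le> length p" "distinct p" "set p \<subseteq> fst G"
    and "successively (\<lambda>x y. {x, y} \<in> snd G) (p @ [hd p])"
  shows "is_cycle G p"
proof -
  have "{p ! i, p ! (Suc i mod length p)} \<in> snd G" if "i < length p" for i
  proof -
    have "{(p @ [hd p]) ! i, (p @ [hd p]) ! Suc i} \<in> snd G"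
      using assms(4) that by (simp add: successively_conv_nth)
    moreover have "p \<noteq> []" using that by auto
    ultimately show ?thesis
      using that hd_conv_nth[of p]
      by (cases "Suc i = length p") (auto simp: nth_append split: if_splits)
  qed
  then show ?thesis using assms unfolding is_cycle_def by blast
qed

text \<open>Here \<open>f i k\<close> is vertex \<open>i\<close> of the hexagon numbered
  \<open>k\<close> modulo \<open>N\<close>. The chords join opposite vertices, \<open>0\<close> to
  \<open>3\<close> and \<open>2\<close> to \<open>5\<close>, while shifting the number by
  \<open>x\<close> or \<open>y\<close>. Going along \<open>x\<close>, \<open>y\<close>,
  \<open>- x\<close>, \<open>- y\<close> returns to hexagon \<open>0\<close>; the length depends on
  which way each hexagon is traversed between two chords.\<close>

lemma hexagon_cycles:
  fixes G :: "'v ugraph" and f :: "nat \<Rightarrow> int \<Rightarrow> 'v" and N x y :: int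
  assumes inj: "\<And>i k l. i < 6 \<Longrightarrow> f i k = f i l \<longleftrightarrow> N dvd k - l"
    and vert: "\<And>i k. i < 6 \<Longrightarrow> f i k \<in> fst G"
    and disj: "\<And>i j k l. i < 6 \<Longrightarrow> j < 6 \<Longrightarrow> i \<noteq> j \<Longrightarrow> f i k \<noteq> f j l"
    and hex: "\<And>i k. i < 6 \<Longrightarrow> {f i k, f (Suc i mod 6) k} \<in> snd G"
    and chord_x: "\<And>k. {f 0 k, f 3 (k + x)} \<in> snd G"
    and chord_y: "\<And>k. {f 2 k, f 5 (k + y)} \<in> snd G"
    and no4: "\<And>p. is_cycle G p \<Longrightarrow> length p \<noteq> 4"
  shows "\<exists>p. is_cycle G p \<and> length p = 14"
    and "\<exists>p. is_cycle G p \<and> length p \<in> {8, 16}"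
proof -
  define u c\<^sub>1 r\<^sub>1 v r\<^sub>2 c\<^sub>2 where vs: "u = f 0" "c\<^sub>1 = f 1" "r\<^sub>1 = f 2" "v = f 3" "r\<^sub>2 = f 4" "c\<^sub>2 = f 5"
  have h: "{u k, c\<^sub>1 k} \<in> snd G" "{c\<^sub>1 k, r\<^sub>1 k} \<in> snd G" "{r\<^sub>1 k, v k} \<in> snd G"
    "{v k, r\<^sub>2 k} \<in> snd G" "{r\<^sub>2 k, c\<^sub>2 k} \<in> snd G" "{c\<^sub>2 k, u k} \<in> snd G" for k
    using hex[of 0 k] hex[of 1 k] hex[of 2 k] hex[of 3 k] hex[of 4 k] hex[of 5 k]
    by (simp_all add: vs Suc_1 flip: One_nat_def)
  have h': "{c\<^sub>1 k, u k} \<in> snd G" "{r\<^sub>1 k, c\<^sub>1 k} \<in> snd G" "{v k, r\<^sub>1 k} \<in> snd G"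
    "{r\<^sub>2 k, v k} \<in> snd G" "{c\<^sub>2 k, r\<^sub>2 k} \<in> snd G" "{u k, c\<^sub>2 k} \<in> snd G" for k
    using h[of k] by (simp_all add: insert_commute)
  note h = h h'
  have ux: "{u k, v l} \<in> snd G \<and> {v l, u k} \<in> snd G" if "l = k + x" for k l
    using chord_x[of k] that unfolding vs by (simp add: insert_commute)
  have ry: "{r\<^sub>1 k, c\<^sub>2 l} \<in> snd G \<and> {c\<^sub>2 l, r\<^sub>1 k} \<in> snd G" if "l = k + y" for k l
    using chord_y[of k] that unfolding vs by (simp add: insert_commute)
  have d: "u k \<noteq> c\<^sub>1 l" "u k \<noteq> r\<^sub>1 l" "u k \<noteq> v l" "u k \<noteq> r\<^sub>2 l" "u k \<noteq> c\<^sub>2 l"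
    "c\<^sub>1 k \<noteq> r\<^sub>1 l" "c\<^sub>1 k \<noteq> v l" "c\<^sub>1 k \<noteq> r\<^sub>2 l" "c\<^sub>1 k \<noteq> c\<^sub>2 l"
    "r\<^sub>1 k \<noteq> v l" "r\<^sub>1 k \<noteq> r\<^sub>2 l" "r\<^sub>1 k \<noteq> c\<^sub>2 l"
    "v k \<noteq> r\<^sub>2 l" "v k \<noteq> c\<^sub>2 l" "r\<^sub>2 k \<noteq> c\<^sub>2 l" for k l
    unfolding vs by (rule disj; simp)+
  note d = d d[symmetric]
  have i: "u k = u l \<longleftrightarrow> N dvd k - l" "c\<^sub>1 k = c\<^sub>1 l \<longleftrightarrow> N dvd k - l" "r\<^sub>1 k = r\<^sub>1 l \<longleftrightarrow> N dvd k - l"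
    "v k = v l \<longleftrightarrow> N dvd k - l" "r\<^sub>2 k = r\<^sub>2 l \<longleftrightarrow> N dvd k - l" "c\<^sub>2 k = c\<^sub>2 l \<longleftrightarrow> N dvd k - l" for k l
    unfolding vs by (rule inj; simp)+
  have V: "u k \<in> fst G" "c\<^sub>1 k \<in> fst G" "r\<^sub>1 k \<in> fst G" "v k \<in> fst G" "r\<^sub>2 k \<in> fst G" "c\<^sub>2 k \<in> fst G" for k
    unfolding vs by (rule vert; simp)+
  have sq: "False" if "distinct [a, b, c, e]" "{a, b, c, e} \<subseteq> fst G"
    "{a, b} \<in> snd G" "{b, c} \<in> snd G" "{c, e} \<in> snd G" "{e, a} \<in> snd G" for a b c e
  proof -
    have "is_cycle G [a, b, c, e]"
      using that by (intro is_cycleI) simp_all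
    then show False using no4 by fastforce
  qed
  \<comment> \<open>A chord staying inside one hexagon would cut it into 4-cycles.\<close>
  have x: "\<not> N dvd x"
  proof
    assume "N dvd x"
    then have "v 0 = v x" by (simp add: i)
    then show False using sq[of "u 0" "c\<^sub>1 0" "r\<^sub>1 0" "v 0"] h[of 0] ux[of x 0] d V by auto
  qed
  have y: "\<not> N dvd y"
  proof
    assume "N dvd y"
    then have "c\<^sub>2 0 = c\<^sub>2 y" by (simp add: i)
    then show False using sq[of "u 0" "c\<^sub>1 0" "r\<^sub>1 0" "c\<^sub>2 0"] h[of 0] ry[of y 0] d V by auto
  qed
  \<comment> \<open>Otherwise an \<open>x\<close> chord and a \<open>y\<close> chord already lead
    back to hexagon \<open>0\<close>, next to the starting vertex.\<close>
  have xy: "\<not> N dvd x + y"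
  proof
    assume "N dvd x + y"
    then have "c\<^sub>2 (x + y) = c\<^sub>2 0" by (simp add: i)
    then show False
      using sq[of "u 0" "v x" "r\<^sub>1 x" "c\<^sub>2 (x + y)"] h[of 0] h[of x] ux[of x 0] ry[of "x + y" x] d V by auto
  qed
  have neg: "N dvd - x - y \<longleftrightarrow> N dvd x + y"
    by (metis dvd_minus_iff minus_add_distrib uminus_add_conv_diff add.commute diff_conv_add_uminus)
  \<comment> \<open>Four chords and paths of 1, 4, 1 and 4 edges in the hexagons \<open>x\<close>,
    \<open>x + y\<close>, \<open>y\<close> and \<open>0\<close>. Vertices of the same kind occur at
    levels that differ by \<open>x\<close>, \<open>y\<close> or \<open>x + y\<close> up to sign,
    never by \<open>x - y\<close>.\<close>
  let ?p = "[u 0, v x, r\<^sub>1 x, c\<^sub>2 (x + y), u (x + y), c\<^sub>1 (x + y), r\<^sub>1 (x + y), v (x + y), u y, c\<^sub>2 y,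
    r\<^sub>1 0, v 0, r\<^sub>2 0, c\<^sub>2 0]"
  have "distinct ?p" using x y xy neg by (simp add: i d)
  moreover have "successively (\<lambda>x y. {x, y} \<in> snd G) (?p @ [hd ?p])"
    by (simp add: h ux ry)
  moreover have "set ?p \<subseteq> fst G" using V by simp
  ultimately have "is_cycle G ?p" by (intro is_cycleI) simp_all
  then show "\<exists>p. is_cycle G p \<and> length p = 14" by (intro exI[of _ ?p]) simp
  show "\<exists>p. is_cycle G p \<and> length p \<in> {8, 16}"
  proof (cases "N dvd x - y")
    case True
    then have eq: "c\<^sub>2 x = c\<^sub>2 y" by (simp add: i)
    \<comment> \<open>As \<open>x\<close> and \<open>y\<close> agree modulo \<open>N\<close>, both
      chords join hexagon \<open>0\<close> to hexagon \<open>x\<close>: an \<open>x\<close> chord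
      leads there and a \<open>y\<close> chord leads back.\<close>
    let ?p = "[u 0, v x, r\<^sub>1 x, c\<^sub>1 x, u x, c\<^sub>2 x, r\<^sub>1 0, c\<^sub>1 0]"
    have e: "{c\<^sub>2 x, r\<^sub>1 0} \<in> snd G" using ry[of y 0] eq by simp
    have "distinct ?p" using x y xy neg by (simp add: i d)
    moreover have "successively (\<lambda>x y. {x, y} \<in> snd G) (?p @ [hd ?p])"
      by (simp add: h ux ry e)
    moreover have "set ?p \<subseteq> fst G" using V by simp
    ultimately have "is_cycle G ?p" by (intro is_cycleI) simp_all
    then show ?thesis by (intro exI[of _ ?p]) simp
  next
    case False
    \<comment> \<open>The paths inside the hexagons now have 5, 2, 1 and 4 edges. The vertices
      \<open>u x\<close> and \<open>u y\<close> both occur, hence the case distinction on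
      \<open>x - y\<close>.\<close>
    let ?p = "[u 0, v x, r\<^sub>2 x, c\<^sub>2 x, u x, c\<^sub>1 x, r\<^sub>1 x, c\<^sub>2 (x + y), r\<^sub>2 (x + y), v (x + y), u y, c\<^sub>2 y,
      r\<^sub>1 0, v 0, r\<^sub>2 0, c\<^sub>2 0]"
    have "distinct ?p" using x y xy neg False by (simp add: i d)
    moreover have "successively (\<lambda>x y. {x, y} \<in> snd G) (?p @ [hd ?p])"
      by (simp add: h ux ry)
    moreover have "set ?p \<subseteq> fst G" using V by simp
    ultimately have "is_cycle G ?p" by (intro is_cycleI) simp_all
    then show ?thesis by (intro exI[of _ ?p]) simp
  qed
qed

section \<open>Liftings as voltage assignments\<close>

definition proj :: "nat \<Rightarrow> nat + nat \<Rightarrow> nat + nat" where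
  "proj N = map_sum (\<lambda>p. p div N) (\<lambda>q. q div N)"

text \<open>Only the residue modulo \<open>N\<close> matters: \<open>p\<close> is congruent to its offset \<open>p mod N\<close> in its block.\<close>

definition level :: "nat + nat \<Rightarrow> int" where
  "level = case_sum int int"

definition at_level :: "nat \<Rightarrow> nat + nat \<Rightarrow> int \<Rightarrow> nat + nat" where
  "at_level N x k = map_sum (\<lambda>a. a * N + nat (k mod int N)) (\<lambda>b. b * N + nat (k mod int N)) x"

text \<open>Reversing an edge negates its voltage. The default \<open>0\<close> concerns pairs on
  the same side, which are never edges.\<close>

definition voltage :: "(nat \<times> nat \<Rightarrow> int) \<Rightarrow> nat + nat \<Rightarrow> nat + nat \<Rightarrow> int" where
  "voltage s x y = (case (x, y) of (Inl a, Inr b) \<Rightarrow> s (a, b) | (Inr b, Inl a) \<Rightarrow> - s (a, b) | _ \<Rightarrow> 0)"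

text \<open>The derived graph of a voltage assignment, in matrix form. Whole indices
  \<open>p\<close> and \<open>q\<close> may replace the offsets inside the blocks, since they agree
  modulo \<open>N\<close>.\<close>

definition voltage_lift :: "nat \<Rightarrow> (nat \<times> nat \<Rightarrow> int) \<Rightarrow> bit mat \<Rightarrow> bit mat \<Rightarrow> bool" where
  "voltage_lift N s B H \<longleftrightarrow> 0 < N \<and> H \<in> carrier_mat (dim_row B * N) (dim_col B * N) \<and>
     (\<forall>p<dim_row H. \<forall>q<dim_col H. H $$ (p, q) = 1 \<longleftrightarrow>
        B $$ (p div N, q div N) = 1 \<and> int N dvd int q - int p - s (p div N, q div N))"

section \<open>Vertices and edges of a voltage lift\<close>

lemma tanner_edge_iff:
  "{x, y} \<in> snd (tanner_graph H) \<longleftrightarrow>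
     (\<exists>a b. a < dim_row H \<and> b < dim_col H \<and> H $$ (a, b) = 1 \<and>
        (x = Inl a \<and> y = Inr b \<or> x = Inr b \<and> y = Inl a))"
  unfolding tanner_graph_def by (auto simp: doubleton_eq_iff)

lemma proj_at_level [simp]: "0 < N \<Longrightarrow> proj N (at_level N x k) = x"
  by (cases x) (auto simp: proj_def at_level_def nat_less_iff)

lemma level_at_level: 
  assumes "0 < N" shows "int N dvd level (at_level N x k) - k"
proof -
  have "int N dvd k mod int N - k" by (metis dvd_minus_mod dvd_diff_commute)
  then have "int N dvd int a * int N + (k mod int N - k)" for a by simp
  then show ?thesis
    using assms by (cases x) (auto simp: at_level_def level_def add_diff_eq)
qed

lemma vertex_eqI:
  assumes "proj N x = proj N y" "int N dvd level x - level y"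
  shows "x = y"
proof -
  have eq: "p = q" if "p div N = q div N" "int N dvd int p - int q" for p q :: nat
  proof -
    have "p mod N = q mod N" using that(2) by (metis mod_eq_dvd_iff of_nat_eq_iff of_nat_mod)
    then show ?thesis using that(1) by (metis div_mult_mod_eq)
  qed
  show ?thesis
    using assms by (cases x; cases y) (auto simp: proj_def level_def intro: eq)
qed

lemma at_level_eq_iff:
  assumes "0 < N"
  shows "at_level N x k = at_level N y l \<longleftrightarrow> x = y \<and> int N dvd k - l"
proof
  assume eq: "at_level N x k = at_level N y l"
  then have "x = y" using proj_at_level[OF assms] by metis
  moreover have "int N dvd (level (at_level N y l) - l) - (level (at_level N x k) - k)"
    by (intro dvd_diff[OF level_at_level level_at_level] assms)
  ultimately show "x = y \<and> int N dvd k - l" using eq by simp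
next
  assume *: "x = y \<and> int N dvd k - l"
  then have "k mod int N = l mod int N" by (simp add: mod_eq_dvd_iff)
  then show "at_level N x k = at_level N y l" using * by (simp add: at_level_def)
qed

lemma voltage_lift_vertex_iff:
  assumes "voltage_lift N s B H"
  shows "x \<in> fst (tanner_graph H) \<longleftrightarrow> proj N x \<in> fst (tanner_graph B)"
proof -
  have "0 < N" and dims: "dim_row H = dim_row B * N" "dim_col H = dim_col B * N"
    using assms by (auto simp: voltage_lift_def)
  then have lt: "p < r * N \<longleftrightarrow> p div N < r" for p r
    by (simp add: div_less_iff_less_mult)
  show ?thesis
    by (cases x) (auto simp: tanner_graph_def proj_def dims lt)
qed

text \<open>Exchanging \<open>x\<close> and \<open>y\<close> negates both the level difference and
  the voltage, so one formula serves both orientations.\<close>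

lemma voltage_lift_edge_iff:
  assumes "voltage_lift N s B H"
  shows "{x, y} \<in> snd (tanner_graph H) \<longleftrightarrow> {proj N x, proj N y} \<in> snd (tanner_graph B) \<and>
    int N dvd level y - level x - voltage s (proj N x) (proj N y)"
proof -
  have neg: "int N dvd int p - int q + s e \<longleftrightarrow> int N dvd int q - int p - s e" for p q e
  proof -
    have "int q - int p - s e = - (int p - int q + s e)" by simp
    then show ?thesis by (metis dvd_minus_iff)
  qed
  have N: "0 < N" and dims: "dim_row H = dim_row B * N" "dim_col H = dim_col B * N"
    using assms by (auto simp: voltage_lift_def)
  have H: "H $$ (p, q) = 1 \<longleftrightarrow> B $$ (p div N, q div N) = 1 \<and> int N dvd int q - int p - s (p div N, q div N)"
    if "p < dim_row B * N" "q < dim_col B * N" for p q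
    using assms that dims unfolding voltage_lift_def by metis
  have lt: "p < r * N \<longleftrightarrow> p div N < r" for p r
    using N by (simp add: div_less_iff_less_mult)
  show ?thesis
  proof (cases x; cases y)
    fix p q assume "x = Inl p" "y = Inr q"
    then show ?thesis
      using H[of p q] by (auto simp: tanner_edge_iff proj_def level_def voltage_def dims lt)
  next
    fix p q assume "x = Inr q" "y = Inl p"
    then show ?thesis
      using H[of p q] by (auto simp: tanner_edge_iff proj_def level_def voltage_def dims lt neg)
  qed (auto simp: tanner_edge_iff proj_def)
qed

lemma voltage_lift_at_level_edge:
  assumes H: "voltage_lift N s B H" and xy: "{x, y} \<in> snd (tanner_graph B)"
    and l: "int N dvd l - k - voltage s x y"
  shows "{at_level N x k, at_level N y l} \<in> snd (tanner_graph H)"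
proof -
  have N: "0 < N" using H by (simp add: voltage_lift_def)
  have "int N dvd (level (at_level N y l) - l) - (level (at_level N x k) - k) + (l - k - voltage s x y)"
    by (intro dvd_add[OF dvd_diff[OF level_at_level level_at_level] l] N)
  moreover have "level (at_level N y l) - l - (level (at_level N x k) - k) + (l - k - voltage s x y) =
      level (at_level N y l) - level (at_level N x k) - voltage s x y" by simp
  ultimately have "int N dvd level (at_level N y l) - level (at_level N x k) - voltage s x y"
    by metis
  then show ?thesis
    unfolding voltage_lift_edge_iff[OF H] using N xy by simp
qed

text \<open>The covering property: the level of \<open>b\<close> and the voltage fix the level of
  the neighbour modulo \<open>N\<close>. Hence cycles of the lift project to walks without
  backtracking.\<close>

lemma voltage_lift_neighbor_unique:
  assumes H: "voltage_lift N s B H"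
    and ba: "{b, a} \<in> snd (tanner_graph H)" and bc: "{b, c} \<in> snd (tanner_graph H)"
    and proj: "proj N c = proj N a"
  shows "c = a"
proof -
  have "int N dvd level a - level b - voltage s (proj N b) (proj N a)"
    "int N dvd level c - level b - voltage s (proj N b) (proj N a)"
    using ba bc by (simp_all add: voltage_lift_edge_iff[OF H] proj)
  then have "int N dvd (level c - level b - voltage s (proj N b) (proj N a)) -
      (level a - level b - voltage s (proj N b) (proj N a))"
    by (metis dvd_diff)
  then have "int N dvd level c - level a" by simp
  then show ?thesis using proj by (metis vertex_eqI)
qed

text \<open>In a nonzero block the entry depends only on \<open>j - i\<close> modulo
  \<open>N\<close>, which makes it circulant. Exactly one residue gives a \<open>1\<close>, which
  makes it a permutation matrix.\<close>

lemma is_lifting_if_voltage_lift: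
  assumes "voltage_lift N s B H"
  shows "is_lifting N B H"
proof -
  have N: "0 < N" and H: "H \<in> carrier_mat (dim_row B * N) (dim_col B * N)"
    using assms by (auto simp: voltage_lift_def)
  have lt: "a * N + i < R * N" if "a < R" "i < N" for a i R :: nat
  proof -
    have "a * N + i < Suc a * N" using that by simp
    also have "\<dots> \<le> R * N" using that by (intro mult_le_mono1) simp
    finally show ?thesis .
  qed
  have entry: "block N H a b $$ (i, j) = 1 \<longleftrightarrow> B $$ (a, b) = 1 \<and> int N dvd int j - int i - s (a, b)"
    if "a < dim_row B" "b < dim_col B" "i < N" "j < N" for a b i j
  proof -
    have "int (b * N + j) - int (a * N + i) - s (a, b) = int j - int i - s (a, b) + (int b - int a) * int N"
      by (simp add: algebra_simps)
    then have "int N dvd int (b * N + j) - int (a * N + i) - s (a, b) \<longleftrightarrow> int N dvd int j - int i - s (a, b)"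
      by (metis dvd_add_times_triv_right_iff)
    moreover have "a * N + i < dim_row H" "b * N + j < dim_col H"
      using lt[OF that(1,3)] lt[OF that(2,4)] H by auto
    then have "H $$ (a * N + i, b * N + j) = 1 \<longleftrightarrow> B $$ ((a * N + i) div N, (b * N + j) div N) = 1 \<and>
        int N dvd int (b * N + j) - int (a * N + i) - s ((a * N + i) div N, (b * N + j) div N)"
      using assms unfolding voltage_lift_def by blast
    ultimately show ?thesis
      using that by (simp add: block_def del: of_nat_add of_nat_mult)
  qed
  have uniq: "\<exists>!j. j < N \<and> int N dvd int j - c" for c
  proof (rule ex1I[of _ "nat (c mod int N)"])
    have "int N dvd c mod int N - c" by (metis dvd_minus_mod dvd_diff_commute)
    then show "nat (c mod int N) < N \<and> int N dvd int (nat (c mod int N)) - c"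
      using N by (simp add: nat_less_iff)
    fix j assume "j < N \<and> int N dvd int j - c"
    then have "int j mod int N = c mod int N" "j < N" by (simp_all only: mod_eq_dvd_iff)
    then show "j = nat (c mod int N)" by (metis mod_less nat_int of_nat_mod)
  qed
  have "circulant_permutation_matrix N (block N H a b)"
    if ab: "a < dim_row B" "b < dim_col B" and 1: "B $$ (a, b) = 1" for a b
  proof -
    have "circulant N (block N H a b)"
      unfolding circulant_def
    proof (intro conjI allI impI)
      show "block N H a b \<in> carrier_mat N N" by (simp add: block_def)
      fix i j assume ij: "i < N" "j < N"
      have cong: "int N dvd int (Suc i mod N) - int (Suc i)" for i
        by (metis dvd_minus_mod dvd_diff_commute of_nat_mod)
      have "int N dvd (int (Suc j mod N) - int (Suc j)) - (int (Suc i mod N) - int (Suc i))"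
        by (rule dvd_diff[OF cong cong])
      moreover have "int (Suc j mod N) - int (Suc i mod N) - s (a, b) =
          (int (Suc j mod N) - int (Suc j)) - (int (Suc i mod N) - int (Suc i)) + (int j - int i - s (a, b))"
        by simp
      ultimately have "int N dvd int (Suc j mod N) - int (Suc i mod N) - s (a, b) \<longleftrightarrow>
          int N dvd int j - int i - s (a, b)"
        by (metis dvd_add_right_iff)
      then have "block N H a b $$ (Suc i mod N, Suc j mod N) = 1 \<longleftrightarrow> block N H a b $$ (i, j) = 1"
        using entry ab ij N by simp
      then show "block N H a b $$ (Suc i mod N, Suc j mod N) = block N H a b $$ (i, j)"
        by (metis bit_not_one_iff)
    qed
    moreover have "permutation_matrix N (block N H a b)"
      unfolding permutation_matrix_def
    proof (intro conjI allI impI)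
      show "block N H a b \<in> carrier_mat N N" by (simp add: block_def)
      fix i assume i: "i < N"
      have "\<exists>!j. j < N \<and> int N dvd int j - int i - s (a, b)"
        using uniq[of "int i + s (a, b)"] by (simp add: algebra_simps)
      then show "\<exists>!j. j < N \<and> block N H a b $$ (i, j) = 1"
        using entry ab i 1 by (metis (no_types, lifting))
    next
      fix j assume j: "j < N"
      have "int N dvd int i - (int j - s (a, b)) \<longleftrightarrow> int N dvd int j - int i - s (a, b)" for i
        by (subst dvd_diff_commute) (simp add: algebra_simps)
      then have "\<exists>!i. i < N \<and> int N dvd int j - int i - s (a, b)"
        using uniq[of "int j - s (a, b)"] by simp
      then show "\<exists>!i. i < N \<and> block N H a b $$ (i, j) = 1"
        using entry ab j 1 by (metis (no_types, lifting))
    qed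
    ultimately show ?thesis by (simp add: circulant_permutation_matrix_def)
  qed
  moreover have "block N H a b = 0\<^sub>m N N"
    if ab: "a < dim_row B" "b < dim_col B" and 1: "B $$ (a, b) \<noteq> 1" for a b
  proof (rule eq_matI)
    fix i j assume "i < dim_row (0\<^sub>m N N :: bit mat)" "j < dim_col (0\<^sub>m N N :: bit mat)"
    then show "block N H a b $$ (i, j) = (0\<^sub>m N N) $$ (i, j)"
      using entry[OF ab, of i j] 1 by (simp add: bit_not_one_iff)
  qed (simp_all add: block_def)
  ultimately show ?thesis using N H by (simp add: is_lifting_def)
qed

text \<open>A circulant is determined by row \<open>0\<close>, and in a permutation matrix this row
  has a single \<open>1\<close>. Its column is the voltage.\<close>

lemma voltage_lift_if_is_lifting:
  assumes "is_lifting N B H"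
  obtains s where "voltage_lift N s B H"
proof -
  have N: "0 < N" and H: "H \<in> carrier_mat (dim_row B * N) (dim_col B * N)"
    using assms by (auto simp: is_lifting_def)
  have circ: "circulant_permutation_matrix N (block N H a b)"
    if "a < dim_row B" "b < dim_col B" "B $$ (a, b) = 1" for a b
    using assms that by (auto simp: is_lifting_def)
  have shift: "A $$ (i, j) = A $$ (0, nat ((int j - int i) mod int N))"
    if A: "circulant N A" and ij: "i < N" "j < N" for A i j
    using ij
  proof (induction i arbitrary: j)
    case 0
    then show ?case by (simp flip: of_nat_mod)
  next
    case (Suc i)
    define j' where "j' = nat ((int j - 1) mod int N)"
    have j': "j' < N" and ji: "int j' = (int j - 1) mod int N"
      using N by (simp_all add: j'_def nat_less_iff)
    have "int (Suc j' mod N) = ((int j - 1) mod int N + 1) mod int N"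
      by (simp add: zmod_int ji add.commute)
    also have "\<dots> = int j" using Suc.prems by (simp add: mod_simps)
    finally have "Suc j' mod N = j" by simp
    then have "A $$ (Suc i, j) = A $$ (i, j')"
      using A j' Suc.prems unfolding circulant_def by (metis Suc_lessD mod_less)
    also have "\<dots> = A $$ (0, nat ((int j' - int i) mod int N))"
      using Suc j' by simp
    also have "(int j' - int i) mod int N = (int j - int (Suc i)) mod int N"
      unfolding ji by (simp add: mod_simps algebra_simps)
    finally show ?case .
  qed
  have "\<exists>t. \<forall>i<N. \<forall>j<N. block N H a b $$ (i, j) = 1 \<longleftrightarrow> int N dvd int j - int i - t"
    if "a < dim_row B" "b < dim_col B" "B $$ (a, b) = 1" for a b
  proof -
    have A: "circulant N (block N H a b)" and P: "permutation_matrix N (block N H a b)"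
      using circ[OF that] by (simp_all add: circulant_permutation_matrix_def)
    obtain t where t: "\<And>j. j < N \<Longrightarrow> block N H a b $$ (0, j) = 1 \<longleftrightarrow> j = t" "t < N"
      using P N unfolding permutation_matrix_def by metis
    have "block N H a b $$ (i, j) = 1 \<longleftrightarrow> int N dvd int j - int i - int t" if "i < N" "j < N" for i j
    proof -
      have "block N H a b $$ (i, j) = 1 \<longleftrightarrow> nat ((int j - int i) mod int N) = t"
        unfolding shift[OF A that] using t(1) N by (simp add: nat_less_iff)
      also have "\<dots> \<longleftrightarrow> (int j - int i) mod int N = int t mod int N"
        using t(2) N by (auto simp: nat_eq_iff)
      finally show ?thesis by (simp add: mod_eq_dvd_iff)
    qed
    then show ?thesis by blast
  qed
  then obtain s where s: "block N H a b $$ (i, j) = 1 \<longleftrightarrow> int N dvd int j - int i - s a b"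
    if "a < dim_row B" "b < dim_col B" "B $$ (a, b) = 1" "i < N" "j < N" for a b i j
    by metis
  \<comment> \<open>The added multiple of \<open>N\<close> accounts for passing from offsets to
    whole indices, so that the two differences are equal as integers and not just congruent.\<close>
  have "H $$ (p, q) = 1 \<longleftrightarrow> B $$ (p div N, q div N) = 1 \<and>
      int N dvd int q - int p - (case (p div N, q div N) of (a, b) \<Rightarrow> s a b + int N * (int b - int a))"
    if pq: "p < dim_row H" "q < dim_col H" for p q
  proof -
    have ab: "p div N < dim_row B" "q div N < dim_col B"
      using pq H N by (auto simp: div_less_iff_less_mult)
    have e: "H $$ (p, q) = block N H (p div N) (q div N) $$ (p mod N, q mod N)"
      using N by (simp add: block_def)
    show ?thesis
    proof (cases "B $$ (p div N, q div N) = 1")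
      case True
      have "int p = int (p div N) * int N + int (p mod N)" "int q = int (q div N) * int N + int (q mod N)"
        by (metis div_mult_mod_eq of_nat_add of_nat_mult)+
      then have eq: "int q - int p - (s (p div N) (q div N) + int N * (int (q div N) - int (p div N)))
        = int (q mod N) - int (p mod N) - s (p div N) (q div N)"
        by (simp add: algebra_simps)
      then show ?thesis
        unfolding e prod.case eq using s[OF ab True, of "p mod N" "q mod N"] N True by simp
    next
      case False
      then have "block N H (p div N) (q div N) = 0\<^sub>m N N"
        using assms ab by (auto simp: is_lifting_def)
      then show ?thesis using False e N by simp
    qed
  qed
  then have "voltage_lift N (\<lambda>(a, b). s a b + int N * (int b - int a)) B H"
    unfolding voltage_lift_def using N H by simp
  then show ?thesis by (rule that)
qed

section \<open>Edge counts of lifted cycles\<close>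

definition dart :: "nat \<times> nat \<Rightarrow> nat + nat \<Rightarrow> nat + nat \<Rightarrow> int" where
  "dart e x y = (if x = Inl (fst e) \<and> y = Inr (snd e) then 1
     else if x = Inr (snd e) \<and> y = Inl (fst e) then - 1 else 0)"

text \<open>The coefficient at \<open>e\<close> of the closed walk viewed as a 1-chain, with the
  direction from row to column counted positively.\<close>

definition flow :: "nat \<times> nat \<Rightarrow> (nat + nat) list \<Rightarrow> int" where
  "flow e p = (\<Sum>j<length p. dart e (p ! j) (p ! (Suc j mod length p)))"

lemma dart_nonzero_iff: "dart e x y \<noteq> 0 \<longleftrightarrow> {x, y} = {Inl (fst e), Inr (snd e)}"
  by (auto simp: dart_def doubleton_eq_iff)

lemma dart_opposite: "dart e x y = - dart e x' y' \<Longrightarrow> dart e x y \<noteq> 0 \<Longrightarrow> x' = y \<and> y' = x"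
  by (auto simp: dart_def split: if_splits)

lemma abs_dart_le_1: "\<bar>dart e x y\<bar> \<le> 1"
  by (simp add: dart_def)

lemma abs_flow_le: "\<bar>flow e p\<bar> \<le> int (length p)"
proof -
  have "\<bar>flow e p\<bar> \<le> (\<Sum>j<length p. \<bar>dart e (p ! j) (p ! (Suc j mod length p))\<bar>)"
    unfolding flow_def by (rule sum_abs)
  also have "\<dots> \<le> (\<Sum>j<length p. 1)" by (intro sum_mono abs_dart_le_1)
  finally show ?thesis by simp
qed

text \<open>Each step of \<open>p\<close> contributes to at most one edge \<open>e\<close>, and by
  at most \<open>1\<close>.\<close>

lemma sum_abs_flow_le:
  assumes "finite E"
  shows "(\<Sum>e\<in>E. \<bar>flow e p\<bar>) \<le> int (length p)"
proof -
  have one: "(\<Sum>e\<in>E. \<bar>dart e x y\<bar>) \<le> 1" for x y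
  proof -
    have "\<exists>e0. \<forall>e. dart e x y \<noteq> 0 \<longrightarrow> e = e0"
      by (cases x; cases y) (auto simp: dart_def)
    then obtain e0 where "\<And>e. e \<noteq> e0 \<Longrightarrow> dart e x y = 0" by blast
    then have "(\<Sum>e\<in>E. \<bar>dart e x y\<bar>) = (\<Sum>e\<in>E. if e = e0 then \<bar>dart e0 x y\<bar> else 0)"
      by (intro sum.cong) auto
    also have "\<dots> \<le> 1" using assms abs_dart_le_1[of e0 x y] by simp
    finally show ?thesis .
  qed
  have "(\<Sum>e\<in>E. \<bar>flow e p\<bar>) \<le> (\<Sum>e\<in>E. \<Sum>j<length p. \<bar>dart e (p ! j) (p ! (Suc j mod length p))\<bar>)"
    unfolding flow_def by (intro sum_mono sum_abs)
  also have "\<dots> = (\<Sum>j<length p. \<Sum>e\<in>E. \<bar>dart e (p ! j) (p ! (Suc j mod length p))\<bar>)"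
    by (rule sum.swap)
  also have "\<dots> \<le> (\<Sum>j<length p. 1)" by (intro sum_mono one)
  finally show ?thesis by simp
qed

text \<open>Only the term of the traversed edge survives. In this form the total voltage of a closed
  walk is linear in its flow.\<close>

lemma voltage_eq_sum_dart:
  assumes "{x, y} \<in> snd (tanner_graph B)"
  shows "voltage s x y = (\<Sum>e\<in>{..<dim_row B} \<times> {..<dim_col B}. s e * dart e x y)"
proof -
  let ?E = "{..<dim_row B} \<times> {..<dim_col B}"
  obtain a b where ab: "(a, b) \<in> ?E" and xy: "x = Inl a \<and> y = Inr b \<or> x = Inr b \<and> y = Inl a"
    using assms by (auto simp: tanner_edge_iff)
  have "(\<Sum>e\<in>?E. s e * dart e x y) = (\<Sum>e\<in>?E. if e = (a, b) then s (a, b) * dart (a, b) x y else 0)"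
    using xy by (intro sum.cong) (auto simp: dart_def prod_eq_iff)
  also have "\<dots> = s (a, b) * dart (a, b) x y" using ab by (subst sum.delta) auto
  also have "\<dots> = voltage s x y" using xy by (auto simp: dart_def voltage_def)
  finally show ?thesis by simp
qed

section \<open>Going once around a cycle\<close>

lemma sum_rotate:
  fixes f :: "nat \<Rightarrow> 'a :: comm_monoid_add"
  shows "(\<Sum>j<n. f (Suc j mod n)) = (\<Sum>j<n. f j)"
proof (cases n)
  case (Suc m)
  have "(\<Sum>j<m. f (Suc j mod n)) = (\<Sum>j<m. f (Suc j))"
    by (intro sum.cong) (auto simp: Suc)
  then show ?thesis
    using sum.lessThan_Suc_shift[of f m] by (simp add: Suc add.commute)
qed simp

lemma is_cycle_step_back:
  assumes "is_cycle G p" "i < length p"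
  shows "p ! (Suc (Suc i mod length p) mod length p) \<noteq> p ! i"
proof -
  have L: "3 \<le> length p" "distinct p" using assms by (auto simp: is_cycle_def)
  have "Suc (Suc i mod length p) mod length p = (i + 2) mod length p" by (simp add: mod_simps)
  moreover have "(i + 2) mod length p \<noteq> i"
    using L(1) assms(2) by (cases "i + 2 < length p") (auto simp: le_mod_geq)
  moreover have "(i + 2) mod length p < length p" using assms(2) by (intro mod_less_divisor) linarith
  ultimately show ?thesis using L assms(2) nth_eq_iff_index_eq by metis
qed

text \<open>Two steps sharing an edge at different indices would be opposite to each other, so each
  index would be the successor of the other, against \<open>is_cycle_step_back\<close>.\<close>

lemma is_cycle_edges_distinct:
  assumes p: "is_cycle G p" and ij: "i < length p" "j < length p"
    and eq: "{p ! i, p ! (Suc i mod length p)} = {p ! j, p ! (Suc j mod length p)}"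
  shows "i = j"
proof (rule ccontr)
  assume "i \<noteq> j"
  have L: "3 \<le> length p" "distinct p" using p by (auto simp: is_cycle_def)
  have lt: "Suc k mod length p < length p" for k using ij(1) by (intro mod_less_divisor) linarith
  have "p ! i \<noteq> p ! j" using L ij \<open>i \<noteq> j\<close> by (simp add: nth_eq_iff_index_eq)
  then have "p ! i = p ! (Suc j mod length p)" "p ! (Suc i mod length p) = p ! j"
    using eq by (auto simp: doubleton_eq_iff)
  then have "i = Suc j mod length p" "Suc i mod length p = j"
    using L ij lt by (simp_all add: nth_eq_iff_index_eq)
  then show False using is_cycle_step_back[OF p ij(1)] by simp
qed

text \<open>Each level difference is congruent to the voltage of its step, and the level differences
  cancel around the cycle. Exchanging the sums groups the total voltage by edges.\<close>

lemma lifted_cycle_flow: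
  assumes H: "voltage_lift N s B H" and p: "is_cycle (tanner_graph H) p"
  shows "int N dvd (\<Sum>e\<in>{..<dim_row B} \<times> {..<dim_col B}. s e * flow e (map (proj N) p))"
proof -
  let ?L = "length p" and ?E = "{..<dim_row B} \<times> {..<dim_col B}"
  let ?y = "\<lambda>j. p ! (Suc j mod ?L)"
  have L: "0 < ?L" using p by (auto simp: is_cycle_def)
  have edge: "{p ! j, ?y j} \<in> snd (tanner_graph H)" if "j < ?L" for j
    using p that by (simp add: is_cycle_def)
  have "(\<Sum>e\<in>?E. s e * flow e (map (proj N) p)) =
      (\<Sum>e\<in>?E. \<Sum>j<?L. s e * dart e (proj N (p ! j)) (proj N (?y j)))"
    using L by (simp add: flow_def sum_distrib_left)
  also have "\<dots> = (\<Sum>j<?L. \<Sum>e\<in>?E. s e * dart e (proj N (p ! j)) (proj N (?y j)))"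
    by (rule sum.swap)
  also have "\<dots> = (\<Sum>j<?L. voltage s (proj N (p ! j)) (proj N (?y j)))"
    using edge by (intro sum.cong voltage_eq_sum_dart[symmetric])
      (simp_all add: voltage_lift_edge_iff[OF H])
  finally have eq: "(\<Sum>e\<in>?E. s e * flow e (map (proj N) p)) =
    (\<Sum>j<?L. voltage s (proj N (p ! j)) (proj N (?y j)))" .
  have "int N dvd (\<Sum>j<?L. level (?y j) - level (p ! j) - voltage s (proj N (p ! j)) (proj N (?y j)))"
    using edge by (intro dvd_sum) (simp add: voltage_lift_edge_iff[OF H])
  also have "(\<Sum>j<?L. level (?y j) - level (p ! j) - voltage s (proj N (p ! j)) (proj N (?y j))) =
      - (\<Sum>j<?L. voltage s (proj N (p ! j)) (proj N (?y j)))"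
    using sum_rotate[of "\<lambda>j. level (p ! j)" ?L] by (simp add: sum_subtractf)
  finally show ?thesis unfolding eq by simp
qed

text \<open>If no term were opposite to \<open>g i\<close>, all products \<open>g i * g j\<close>
  would be nonnegative and one of them \<open>1\<close>, although they sum to \<open>0\<close>. It
  turns zero flow into a traversal in the reverse direction.\<close>

lemma sum_opposite_unit:
  fixes g :: "'a \<Rightarrow> int"
  assumes "finite S" "sum g S = 0" "i \<in> S" "g i \<noteq> 0" "\<And>j. j \<in> S \<Longrightarrow> \<bar>g j\<bar> \<le> 1"
  shows "\<exists>j\<in>S. g i = - g j"
proof (rule ccontr)
  assume neg: "\<not> ?thesis"
  have gi: "g i * g i = 1" 
  proof -
    have "g i = 1 \<or> g i = - 1" using assms(4) assms(5)[OF assms(3)] by linarith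
    then show ?thesis by auto
  qed
  have "0 \<le> g i * g j" if "j \<in> S" for j
  proof -
    have "g i \<in> {-1, 1}" "g j \<in> {-1, 0, 1}"
      using assms(4) assms(5)[OF assms(3)] assms(5)[OF that] by auto
    then show ?thesis using neg that by auto
  qed
  then have "g i * g i \<le> (\<Sum>j\<in>S. g i * g j)"
    using assms(1,3) by (intro member_le_sum) auto
  also have "\<dots> = 0" using assms(2) by (simp flip: sum_distrib_left)
  finally show False using gi by simp
qed

text \<open>The projected cycle, indexed periodically by integers, is a walk as in
  \<open>balanced_walk_length\<close>: zero flow supplies reverse traversals, and uniqueness of
  lifted neighbours excludes backtracking.\<close>

lemma balanced_lifted_cycle_length:
  assumes H: "voltage_lift N s B H" and p: "is_cycle (tanner_graph H) p"
    and no4: "\<And>q. is_cycle (tanner_graph B) q \<Longrightarrow> length q \<noteq> 4"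
    and bal: "\<And>e. e \<in> {..<dim_row B} \<times> {..<dim_col B} \<Longrightarrow> flow e (map (proj N) p) = 0"
  shows "18 \<le> length p"
proof -
  let ?L = "length p"
  define ix where "ix i = nat (i mod int ?L)" for i
  define w where "w i = proj N (p ! ix i)" for i
  define A where "A x y \<longleftrightarrow> {x, y} \<in> snd (tanner_graph B)" for x y
  have L: "0 < ?L" using p by (auto simp: is_cycle_def)
  have ix: "ix i < ?L" for i using L by (simp add: ix_def nat_less_iff)
  have ix1: "ix (i + 1) = Suc (ix i) mod ?L" for i
  proof -
    have "int (ix (i + 1)) = int (Suc (ix i) mod ?L)"
      using L by (simp add: ix_def zmod_int mod_simps add.commute)
    then show ?thesis by linarith
  qed
  have edgeH: "{p ! ix i, p ! ix (i + 1)} \<in> snd (tanner_graph H)" for i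
    using p ix[of i] unfolding ix1 by (simp add: is_cycle_def)
  then have edge: "A (w i) (w (i + 1))" for i
    by (simp add: A_def w_def voltage_lift_edge_iff[OF H])
  show ?thesis
  proof (rule balanced_walk_length[where w = w and A = A and color = isl])
    show "0 < ?L" by (rule L)
    show "w (i + int ?L) = w i" for i by (simp add: w_def ix_def)
    show "isl (w (i + 1)) \<longleftrightarrow> \<not> isl (w i)" for i
      using edge[of i] by (auto simp: A_def tanner_edge_iff)
    show "A (w i) (w (i + 1))" for i by (rule edge)
    show "A y x" if "A x y" for x y using that by (simp add: A_def insert_commute)
    show "w (i + 2) \<noteq> w i" for i
    proof
      assume eq: "w (i + 2) = w i"
      have i2: "ix (i + 2) = Suc (Suc (ix i) mod ?L) mod ?L"
        using ix1[of i] ix1[of "i + 1"] by (simp add: add.assoc)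
      have "{p ! ix (i + 1), p ! ix i} \<in> snd (tanner_graph H)"
        "{p ! ix (i + 1), p ! ix (i + 2)} \<in> snd (tanner_graph H)"
        using edgeH[of i] edgeH[of "i + 1"] by (simp_all add: insert_commute add.assoc)
      then have "p ! ix (i + 2) = p ! ix i"
        using voltage_lift_neighbor_unique[OF H] eq by (simp add: w_def)
      then show False using is_cycle_step_back[OF p ix[of i]] i2 by simp
    qed
    show False if sq: "A a b" "A b c" "A c d" "A d a" "a \<noteq> c" "b \<noteq> d" for a b c d
    proof -
      have ne: "x \<noteq> y \<and> x \<in> fst (tanner_graph B)" if "A x y" for x y
        using that by (auto simp: A_def tanner_edge_iff) (auto simp: tanner_graph_def)
      have "is_cycle (tanner_graph B) [a, b, c, d]"
        using sq ne[OF sq(1)] ne[OF sq(2)] ne[OF sq(3)] ne[OF sq(4)]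
        by (intro is_cycleI) (auto simp: A_def)
      then show False using no4 by fastforce
    qed
    show "\<exists>j. w j = w (i + 1) \<and> w (j + 1) = w i" for i
    proof -
      let ?q = "map (proj N) p"
      obtain a b where ab: "a < dim_row B" "b < dim_col B"
        and xy: "w i = Inl a \<and> w (i + 1) = Inr b \<or> w i = Inr b \<and> w (i + 1) = Inl a"
        using edge[of i] by (auto simp: A_def tanner_edge_iff)
      let ?g = "\<lambda>j. dart (a, b) (?q ! j) (?q ! (Suc j mod ?L))"
      have wq: "w k = ?q ! ix k" for k using ix by (simp add: w_def)
      have "dart (a, b) (w i) (w (i + 1)) \<noteq> 0" using xy by (auto simp: dart_def)
      then have "?g (ix i) \<noteq> 0" unfolding wq ix1 .
      moreover have "sum ?g {..<?L} = 0" using bal[of "(a, b)"] ab by (simp add: flow_def)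
      ultimately obtain j where j: "j < ?L" "?g (ix i) = - ?g j"
        using sum_opposite_unit[of "{..<?L}" ?g "ix i"] ix abs_dart_le_1 by auto
      then have "?q ! j = ?q ! (Suc (ix i) mod ?L)" "?q ! (Suc j mod ?L) = ?q ! ix i"
        using dart_opposite \<open>?g (ix i) \<noteq> 0\<close> by blast+
      moreover have "ix (int j) = j" "ix (int j + 1) = Suc j mod ?L"
        using j(1) ix1[of "int j"] by (simp_all add: ix_def)
      ultimately have "w (int j) = w (i + 1) \<and> w (int j + 1) = w i"
        unfolding wq ix1 by simp
      then show ?thesis by blast
    qed
  qed
qed

text \<open>The weights are the powers of a large base, except that the one at \<open>i\<^sub>0\<close> adjusts the total weight
  of \<open>d\<close> to \<open>M\<close>; being a multiple of \<open>M\<close> then determines all base-\<open>K\<close> digits.\<close>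

lemma generic_weights_lessThan:
  fixes d :: "nat \<Rightarrow> int" and C :: int
  assumes i0: "i\<^sub>0 < n" "\<bar>d i\<^sub>0\<bar> = 1" and d: "\<And>i. i < n \<Longrightarrow> \<bar>d i\<bar> \<le> C"
  obtains M :: nat and s where "0 < M" "(\<Sum>i<n. s i * d i) = int M"
    "\<And>f m. (\<And>i. i < n \<Longrightarrow> \<bar>f i\<bar> \<le> C) \<Longrightarrow> int (m * M) dvd (\<Sum>i<n. s i * f i) \<Longrightarrow>
      \<exists>k. int m dvd k \<and> (\<forall>i<n. f i = k * d i)"
proof -
  let ?I = "{..<n} - {i\<^sub>0}"
  have C: "1 \<le> C" using d[OF i0(1)] i0(2) by simp
  \<comment> \<open>\<open>D\<close> bounds \<open>f i - k * d i\<close> when \<open>f\<close>,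
    \<open>d\<close> and \<open>k\<close> are bounded by \<open>C\<close>; hence such differences
    are admissible digits for base \<open>K\<close>.\<close>
  define D where "D = C + C * C"
  define K where "K = D + 1"
  have K: "0 < K" "0 \<le> D" using C by (simp_all add: D_def K_def)
  \<comment> \<open>\<open>M\<close> exceeds every sum of digits bounded by \<open>D\<close>, so
    such a sum is divisible by \<open>M\<close> only if it is \<open>0\<close>.\<close>
  define M where "M = nat (1 + (\<Sum>i<n. D * K ^ i))"
  have "0 \<le> (\<Sum>i<n. D * K ^ i)" using K by (intro sum_nonneg) simp
  then have M: "0 < M" "int M = 1 + (\<Sum>i<n. D * K ^ i)" by (simp_all add: M_def)
  define s where "s i = (if i = i\<^sub>0 then d i\<^sub>0 * (int M - (\<Sum>i\<in>?I. K ^ i * d i)) else K ^ i)" for i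
  have dd: "d i\<^sub>0 * d i\<^sub>0 = 1" using i0(2) by (cases "d i\<^sub>0 \<ge> 0") auto
  \<comment> \<open>Subtracting the right multiple of \<open>d\<close> from \<open>f\<close> removes
    the coordinate \<open>i\<^sub>0\<close>. As \<open>d i\<^sub>0\<close> is its own inverse, this
    multiple is \<open>f i\<^sub>0 * d i\<^sub>0\<close>.\<close>
  have expand: "(\<Sum>i<n. s i * f i) = f i\<^sub>0 * d i\<^sub>0 * int M + (\<Sum>i\<in>?I. (f i - f i\<^sub>0 * d i\<^sub>0 * d i) * K ^ i)" for f
  proof -
    have "(\<Sum>i<n. s i * f i) = s i\<^sub>0 * f i\<^sub>0 + (\<Sum>i\<in>?I. s i * f i)"
      using i0 by (intro sum.remove) auto
    also have "(\<Sum>i\<in>?I. s i * f i) = (\<Sum>i\<in>?I. K ^ i * f i)"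
      by (intro sum.cong) (auto simp: s_def)
    also have "s i\<^sub>0 * f i\<^sub>0 = f i\<^sub>0 * d i\<^sub>0 * int M - (\<Sum>i\<in>?I. f i\<^sub>0 * d i\<^sub>0 * (K ^ i * d i))"
      by (simp add: s_def algebra_simps sum_distrib_left)
    finally show ?thesis by (simp add: algebra_simps sum_subtractf)
  qed
  have "(\<Sum>i<n. s i * d i) = int M" unfolding expand by (simp add: dd)
  moreover have "\<exists>k. int m dvd k \<and> (\<forall>i<n. f i = k * d i)"
    if f: "\<And>i. i < n \<Longrightarrow> \<bar>f i\<bar> \<le> C" and dvd: "int (m * M) dvd (\<Sum>i<n. s i * f i)" for f m
  proof -
    define k where "k = f i\<^sub>0 * d i\<^sub>0"
    define c where "c i = (if i = i\<^sub>0 then 0 else f i - k * d i)" for i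
    have absk: "\<bar>k\<bar> \<le> C" using f[OF i0(1)] i0(2) by (simp add: k_def abs_mult)
    have c: "\<bar>c i\<bar> \<le> D" if "i < n" for i
    proof -
      have "\<bar>k * d i\<bar> \<le> C * C" unfolding abs_mult using absk d[OF that] C by (intro mult_mono) auto
      then show ?thesis using f[OF that] K unfolding c_def D_def by auto
    qed
    have sum_c: "(\<Sum>i<n. s i * f i) = k * int M + (\<Sum>i<n. c i * K ^ i)"
    proof -
      have "(\<Sum>i<n. c i * K ^ i) = c i\<^sub>0 * K ^ i\<^sub>0 + (\<Sum>i\<in>?I. c i * K ^ i)"
        using i0 by (intro sum.remove) auto
      also have "\<dots> = (\<Sum>i\<in>?I. (f i - k * d i) * K ^ i)"
        by (auto simp: c_def intro: sum.cong)
      finally show ?thesis unfolding expand k_def by simp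
    qed
    have "int M dvd (\<Sum>i<n. s i * f i)" using dvd by (metis dvd_mult_right of_nat_mult)
    then have "int M dvd (\<Sum>i<n. c i * K ^ i)" unfolding sum_c by (simp add: dvd_add_right_iff)
    moreover have "\<bar>\<Sum>i<n. c i * K ^ i\<bar> \<le> (\<Sum>i<n. D * K ^ i)"
      using c K by (intro order.trans[OF sum_abs] sum_mono) (auto simp: abs_mult intro!: mult_right_mono)
    ultimately have zero: "(\<Sum>i<n. c i * K ^ i) = 0"
      using M(2) dvd_imp_le_int[of "\<Sum>i<n. c i * K ^ i" "int M"] by fastforce
    have "c i = 0" if "i < n" for i
      using digits_eq_0[OF zero _ that] c K_def by force
    then have "f i = k * d i" if "i < n" "i \<noteq> i\<^sub>0" for i
      using that by (force simp: c_def)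
    moreover have "f i\<^sub>0 = k * d i\<^sub>0" using dd by (simp add: k_def mult.assoc)
    ultimately have "f i = k * d i" if "i < n" for i
      using that by blast
    \<comment> \<open>With all digits zero, the weighted sum of \<open>f\<close> is exactly
      \<open>k * int M\<close>.\<close>
    moreover have "int m dvd k"
      using dvd M(1) unfolding sum_c zero by simp
    ultimately show ?thesis by blast
  qed
  ultimately show ?thesis using that M(1) by blast
qed

text \<open>The powers of the base require numbered coordinates; an enumeration of \<open>E\<close>
  transports the result.\<close>

lemma generic_weights:
  fixes d :: "'a \<Rightarrow> int" and C :: int
  assumes "finite E" "e\<^sub>0 \<in> E" "\<bar>d e\<^sub>0\<bar> = 1" and d: "\<And>e. e \<in> E \<Longrightarrow> \<bar>d e\<bar> \<le> C"
  obtains M :: nat and s where "0 < M" "(\<Sum>e\<in>E. s e * d e) = int M"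
    "\<And>f m. (\<And>e. e \<in> E \<Longrightarrow> \<bar>f e\<bar> \<le> C) \<Longrightarrow> int (m * M) dvd (\<Sum>e\<in>E. s e * f e) \<Longrightarrow>
      \<exists>k. int m dvd k \<and> (\<forall>e\<in>E. f e = k * d e)"
proof -
  obtain h where h: "bij_betw h {..<card E} E"
    using ex_bij_betw_nat_finite[OF assms(1)] by (auto simp: atLeast0LessThan)
  have hE: "h i \<in> E" if "i < card E" for i using h that by (auto simp: bij_betw_def)
  have "e\<^sub>0 \<in> h ` {..<card E}" using h assms(2) by (simp add: bij_betw_def)
  then obtain i0 where i0: "i0 < card E" "h i0 = e\<^sub>0" by auto
  define g where "g = the_inv_into {..<card E} h"
  have g: "g e < card E" "h (g e) = e" if "e \<in> E" for e
    using h that the_inv_into_into[of h "{..<card E}" e "{..<card E}"]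
    by (auto simp: g_def bij_betw_def f_the_inv_into_f)
  have gh: "g (h i) = i" if "i < card E" for i
    using h that by (simp add: g_def bij_betw_def the_inv_into_f_f)
  have "\<bar>d (h i0)\<bar> = 1" "\<And>i. i < card E \<Longrightarrow> \<bar>d (h i)\<bar> \<le> C"
    using i0 assms(3) d hE by simp_all
  from generic_weights_lessThan[OF i0(1), of "\<lambda>i. d (h i)" C, OF this]
  obtain M s where M: "0 < M" "(\<Sum>i<card E. s i * d (h i)) = int M"
    and gen: "\<And>f m. (\<And>i. i < card E \<Longrightarrow> \<bar>f i\<bar> \<le> C) \<Longrightarrow> int (m * M) dvd (\<Sum>i<card E. s i * f i) \<Longrightarrow>
      \<exists>k. int m dvd k \<and> (\<forall>i<card E. f i = k * d (h i))"
    by blast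
  have sum: "(\<Sum>e\<in>E. s (g e) * f e) = (\<Sum>i<card E. s i * f (h i))" for f
    using sum.reindex_bij_betw[OF h, of "\<lambda>e. s (g e) * f e"] gh by simp
  show ?thesis
  proof (rule that[of M "\<lambda>e. s (g e)"])
    show "0 < M" by (rule M)
    show "(\<Sum>e\<in>E. s (g e) * d e) = int M" unfolding sum by (rule M)
    fix f m
    assume "\<And>e. e \<in> E \<Longrightarrow> \<bar>f e\<bar> \<le> C" "int (m * M) dvd (\<Sum>e\<in>E. s (g e) * f e)"
    then obtain k where "int m dvd k" "\<forall>i<card E. f (h i) = k * d (h i)"
      using gen[of "\<lambda>i. f (h i)" m] hE unfolding sum by blast
    then show "\<exists>k. int m dvd k \<and> (\<forall>e\<in>E. f e = k * d e)" using g by metis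
  qed
qed

section \<open>Liftings of prescribed girth\<close>

text \<open>A cycle uses each of its edges exactly once, so nothing cancels there. The map
  \<open>\<epsilon>\<close> lists these edges in the order of the steps.\<close>

lemma simple_cycle_flow:
  assumes D: "is_cycle (tanner_graph B) D"
  obtains \<epsilon> where "inj_on \<epsilon> {..<length D}" "\<epsilon> ` {..<length D} \<subseteq> {..<dim_row B} \<times> {..<dim_col B}"
    "\<And>j. j < length D \<Longrightarrow> \<bar>flow (\<epsilon> j) D\<bar> = 1"
proof -
  let ?L = "length D" and ?y = "\<lambda>j. D ! (Suc j mod length D)"
  have "\<exists>e. e \<in> {..<dim_row B} \<times> {..<dim_col B} \<and> {D ! j, ?y j} = {Inl (fst e), Inr (snd e)}"
    if "j < ?L" for j
  proof -
    have "{D ! j, ?y j} \<in> snd (tanner_graph B)" using D that by (simp add: is_cycle_def)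
    then obtain a b where "a < dim_row B" "b < dim_col B" "{D ! j, ?y j} = {Inl a, Inr b}"
      unfolding tanner_edge_iff by (auto simp: insert_commute)
    then show ?thesis by (intro exI[of _ "(a, b)"]) simp
  qed
  then obtain \<epsilon> where \<epsilon>: "\<And>j. j < ?L \<Longrightarrow> \<epsilon> j \<in> {..<dim_row B} \<times> {..<dim_col B}"
    "\<And>j. j < ?L \<Longrightarrow> {D ! j, ?y j} = {Inl (fst (\<epsilon> j)), Inr (snd (\<epsilon> j))}"
    by metis
  have nz: "dart (\<epsilon> j) (D ! i) (?y i) \<noteq> 0 \<longleftrightarrow> i = j" if "i < ?L" "j < ?L" for i j
    unfolding dart_nonzero_iff \<epsilon>(2)[OF that(2), symmetric]
    using is_cycle_edges_distinct[OF D that] by blast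
  show ?thesis
  proof (rule that)
    show "inj_on \<epsilon> {..<?L}"
      using nz by (intro inj_onI) (metis lessThan_iff)
    show "\<epsilon> ` {..<?L} \<subseteq> {..<dim_row B} \<times> {..<dim_col B}" using \<epsilon>(1) by blast
    fix j assume j: "j < ?L"
    have "flow (\<epsilon> j) D = (\<Sum>i<?L. if i = j then dart (\<epsilon> j) (D ! j) (?y j) else 0)"
      unfolding flow_def using nz j by (intro sum.cong) auto
    also have "\<dots> = dart (\<epsilon> j) (D ! j) (?y j)" using j by simp
    finally show "\<bar>flow (\<epsilon> j) D\<bar> = 1"
      using nz[OF j j] abs_dart_le_1[of "\<epsilon> j" "D ! j" "?y j"] by simp
  qed
qed

lemma graph_girth_eqI:
  assumes "is_cycle G p" "\<And>q. is_cycle G q \<Longrightarrow> length p \<le> length q"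
  shows "graph_girth G = enat (length p)"
  unfolding graph_girth_def
proof (rule antisym)
  show "(INF q\<in>{q. is_cycle G q}. enat (length q)) \<le> enat (length p)"
    using assms(1) by (intro INF_lower) simp
  show "enat (length p) \<le> (INF q\<in>{q. is_cycle G q}. enat (length q))"
    using assms(2) by (intro INF_greatest) simp
qed

text \<open>Each turn around \<open>D\<close> raises the level by \<open>M\<close>, which has order
  \<open>m\<close> modulo \<open>m * M\<close>. The lift therefore closes after \<open>m\<close>
  turns, and earlier turns meet every vertex of \<open>D\<close> at different levels.\<close>

lemma repeated_cycle_lift:
  assumes H: "voltage_lift (m * M) s B H" and D: "is_cycle (tanner_graph B) D"
    and s: "(\<Sum>e\<in>{..<dim_row B} \<times> {..<dim_col B}. s e * flow e D) = int M"
  shows "\<exists>p. is_cycle (tanner_graph H) p \<and> length p = m * length D"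
proof -
  let ?N = "m * M" and ?L = "length D" and ?E = "{..<dim_row B} \<times> {..<dim_col B}"
  have N: "0 < ?N" using H by (simp add: voltage_lift_def)
  then have m: "0 < m" and M: "0 < M" by auto
  have L: "3 \<le> ?L" "distinct D" "set D \<subseteq> fst (tanner_graph B)"
    using D by (auto simp: is_cycle_def)
  have edge: "{D ! j, D ! (Suc j mod ?L)} \<in> snd (tanner_graph B)" if "j < ?L" for j
    using D that by (simp add: is_cycle_def)
  define \<delta> where "\<delta> j = voltage s (D ! (j mod ?L)) (D ! (Suc j mod ?L))" for j
  \<comment> \<open>The level reached after \<open>i\<close> steps along repeated \<open>D\<close>,
    starting at \<open>0\<close>.\<close>
  define l where "l i = (\<Sum>j<i. \<delta> j)" for i
  have "(\<Sum>j<?L. \<delta> j) = (\<Sum>j<?L. \<Sum>e\<in>?E. s e * dart e (D ! j) (D ! (Suc j mod ?L)))"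
    using edge by (intro sum.cong) (simp_all add: \<delta>_def voltage_eq_sum_dart)
  also have "\<dots> = (\<Sum>e\<in>?E. s e * flow e D)"
    unfolding flow_def sum_distrib_left by (rule sum.swap)
  finally have lL: "l ?L = int M" by (simp add: s l_def)
  have l_add: "l (i + ?L * t) = l i + int t * int M" for i t
  proof (induction t)
    case (Suc t)
    have per: "l (i + ?L) = l i + l ?L" for i
    proof (induction i)
      case (Suc i)
      have "\<delta> (i + ?L) = \<delta> i" by (simp add: \<delta>_def flip: add_Suc)
      then show ?case using Suc by (simp add: l_def)
    qed (simp add: l_def)
    show ?case using per[of "i + ?L * t"] Suc by (simp add: lL algebra_simps)
  qed simp
  have lm: "l (m * ?L) = int ?N" using l_add[of 0 m] by (simp add: l_def mult.commute)
  define v where "v i = at_level ?N (D ! (i mod ?L)) (l i)" for i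
  have vE: "{v i, v (Suc i)} \<in> snd (tanner_graph H)" for i
  proof -
    have "i mod ?L < ?L" using L(1) by (intro mod_less_divisor) linarith
    then have "{D ! (i mod ?L), D ! (Suc i mod ?L)} \<in> snd (tanner_graph B)"
      using edge[of "i mod ?L"] by (simp add: mod_Suc_eq)
    then show ?thesis
      unfolding v_def by (rule voltage_lift_at_level_edge[OF H]) (simp add: l_def \<delta>_def)
  qed
  have v_end: "v (m * ?L) = v 0"
    unfolding v_def at_level_eq_iff[OF N] lm by (simp add: l_def)
  let ?p = "map v [0..<m * ?L]"
  have "inj_on v {0..<m * ?L}"
  proof (rule inj_onI)
    fix i j assume ij: "i \<in> {0..<m * ?L}" "j \<in> {0..<m * ?L}" and eq: "v i = v j"
    have lt: "k mod ?L < ?L" for k using L(1) by (intro mod_less_divisor) linarith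
    have "D ! (i mod ?L) = D ! (j mod ?L)" and dvd: "int ?N dvd l i - l j"
      using eq unfolding v_def at_level_eq_iff[OF N] by auto
    then have mod: "i mod ?L = j mod ?L" using L(2) lt nth_eq_iff_index_eq by metis
    have "l i = l (i mod ?L) + int (i div ?L) * int M" "l j = l (j mod ?L) + int (j div ?L) * int M"
      using l_add[of "i mod ?L" "i div ?L"] l_add[of "j mod ?L" "j div ?L"] by simp_all
    then have "int m * int M dvd (int (i div ?L) - int (j div ?L)) * int M"
      using dvd mod by (simp add: algebra_simps)
    then have "int m dvd int (i div ?L) - int (j div ?L)" using M by simp
    moreover have "i div ?L < m" "j div ?L < m"
      using ij by (simp_all add: less_mult_imp_div_less)
    ultimately have "i div ?L = j div ?L"
      by (metis mod_eq_dvd_iff mod_less of_nat_eq_iff of_nat_mod)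
    then show "i = j" using mod by (metis div_mult_mod_eq)
  qed
  then have "distinct ?p" by (simp add: distinct_map)
  moreover have "3 \<le> length ?p" using L(1) m by (cases m) (auto intro: trans_le_add1)
  moreover have "set ?p \<subseteq> fst (tanner_graph H)"
  proof -
    have "D ! (i mod ?L) \<in> fst (tanner_graph B)" for i
    proof -
      have "i mod ?L < ?L" using L(1) by (intro mod_less_divisor) linarith
      then show ?thesis using L(3) by auto
    qed
    then show ?thesis unfolding v_def voltage_lift_vertex_iff[OF H]
      by (auto simp: voltage_lift_vertex_iff[OF H] proj_at_level[OF N])
  qed
  moreover have "{?p ! i, ?p ! (Suc i mod length ?p)} \<in> snd (tanner_graph H)" if "i < length ?p" for i
  proof (cases "Suc i = m * ?L")
    case True
    then have "Suc i mod length ?p = 0" by simp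
    moreover have "?p ! 0 = v 0" 
    proof -
      have "0 < m * ?L" using m L(1) by (intro mult_pos_pos) auto
      then show ?thesis using nth_upt[of 0 0 "m * ?L"] by (subst nth_map) simp_all
    qed
    ultimately have "?p ! (Suc i mod length ?p) = v 0" by simp
    then show ?thesis using vE[of i] v_end True that by simp
  next
    case False
    then show ?thesis using vE[of i] that by simp
  qed
  ultimately have "is_cycle (tanner_graph H) ?p" by (simp add: is_cycle_def)
  then show ?thesis by (intro exI[of _ ?p]) simp
qed

text \<open>With lifting factor \<open>m * M\<close>, the flow of a cycle shorter than 18 in the
  lift is \<open>k\<close> times that of \<open>D\<close>, with \<open>m\<close> dividing
  \<open>k\<close>. If \<open>k = 0\<close> the cycle is balanced and hence too long; otherwise
  every edge of \<open>D\<close> is used at least \<open>m\<close> times.\<close>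

lemma lifting_of_prescribed_girth:
  assumes no4: "\<And>q. is_cycle (tanner_graph B) q \<Longrightarrow> length q \<noteq> 4"
    and D: "is_cycle (tanner_graph B) D" and m: "0 < m" and le18: "m * length D \<le> 18"
  shows "\<exists>N H. is_lifting N B H \<and> mat_girth H = enat (m * length D)"
proof -
  let ?E = "{..<dim_row B} \<times> {..<dim_col B}" and ?L = "length D"
  obtain \<epsilon> where \<epsilon>: "inj_on \<epsilon> {..<?L}" "\<epsilon> ` {..<?L} \<subseteq> ?E" "\<And>j. j < ?L \<Longrightarrow> \<bar>flow (\<epsilon> j) D\<bar> = 1"
    using simple_cycle_flow[OF D] by metis
  have L: "0 < ?L" using D by (auto simp: is_cycle_def)
  have L18: "?L \<le> 18" using le18 m by (cases m) auto
  \<comment> \<open>The bound 18 fits both \<open>D\<close> and any lifted cycle that is too short,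
    so one choice of weights handles both.\<close>
  have bnd: "\<bar>flow e D\<bar> \<le> 18" for e using abs_flow_le[of e D] L18 by linarith
  have "\<epsilon> 0 \<in> ?E" "\<bar>flow (\<epsilon> 0) D\<bar> = 1" using \<epsilon> L by auto
  from generic_weights[where d = "\<lambda>e. flow e D" and C = 18, OF _ this bnd]
  obtain M s where M: "0 < M" "(\<Sum>e\<in>?E. s e * flow e D) = int M"
    and gen: "\<And>f m. (\<And>e. e \<in> ?E \<Longrightarrow> \<bar>f e\<bar> \<le> 18) \<Longrightarrow> int (m * M) dvd (\<Sum>e\<in>?E. s e * f e) \<Longrightarrow>
      \<exists>k. int m dvd k \<and> (\<forall>e\<in>?E. f e = k * flow e D)"
    by blast
  let ?N = "m * M"
  define H :: "bit mat" where "H = mat (dim_row B * ?N) (dim_col B * ?N) (\<lambda>(p, q).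
    if B $$ (p div ?N, q div ?N) = 1 \<and> int ?N dvd int q - int p - s (p div ?N, q div ?N) then 1 else 0)"
  have H: "voltage_lift ?N s B H"
    using m M(1) by (auto simp: voltage_lift_def H_def)
  have low: "m * ?L \<le> length p" if p: "is_cycle (tanner_graph H) p" for p
  proof (rule ccontr)
    assume "\<not> ?thesis"
    then have short: "length p < m * ?L" "length p < 18" using le18 by simp_all
    define f where "f e = flow e (map (proj ?N) p)" for e
    have "\<bar>f e\<bar> \<le> 18" for e
      using abs_flow_le[of e "map (proj ?N) p"] short by (simp add: f_def)
    moreover have "int ?N dvd (\<Sum>e\<in>?E. s e * f e)"
      unfolding f_def by (rule lifted_cycle_flow[OF H p])
    ultimately obtain k where k: "int m dvd k" "\<And>e. e \<in> ?E \<Longrightarrow> f e = k * flow e D"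
      using gen[of f m] by blast
    show False
    proof (cases "k = 0")
      case True
      then have "18 \<le> length p"
        using k(2) by (intro balanced_lifted_cycle_length[OF H p no4]) (auto simp: f_def)
      then show False using short by simp
    next
      case False
      have "int m \<le> \<bar>k\<bar>" using dvd_imp_le_int[OF False k(1)] by simp
      then have "int (m * ?L) \<le> (\<Sum>j<?L. \<bar>k\<bar>)"
        using mult_left_mono[of "int m" "\<bar>k\<bar>" "int ?L"] by (simp add: mult.commute)
      also have "\<dots> = (\<Sum>j<?L. \<bar>f (\<epsilon> j)\<bar>)"
      proof (intro sum.cong refl)
        fix j assume "j \<in> {..<?L}"
        then have "\<epsilon> j \<in> ?E" "\<bar>flow (\<epsilon> j) D\<bar> = 1" using \<epsilon>(2,3) by blast+
        then show "\<bar>k\<bar> = \<bar>f (\<epsilon> j)\<bar>" using k(2) by (simp add: abs_mult)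
      qed
      also have "\<dots> = (\<Sum>e\<in>\<epsilon> ` {..<?L}. \<bar>f e\<bar>)"
        by (simp add: sum.reindex[OF \<epsilon>(1)])
      also have "\<dots> \<le> (\<Sum>e\<in>?E. \<bar>f e\<bar>)" using \<epsilon>(2) by (intro sum_mono2) auto
      also have "\<dots> \<le> int (length p)"
        using sum_abs_flow_le[of ?E "map (proj ?N) p"] by (simp add: f_def)
      finally have "m * ?L \<le> length p" by (simp only: of_nat_le_iff)
      then show False using short by simp
    qed
  qed
  obtain p where p: "is_cycle (tanner_graph H) p" "length p = m * ?L"
    using repeated_cycle_lift[OF H D M(2)] by blast
  have "mat_girth H = enat (m * ?L)"
    unfolding mat_girth_def p(2)[symmetric] using low p by (intro graph_girth_eqI) auto
  then show ?thesis using is_lifting_if_voltage_lift[OF H] by blast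
qed

text \<open>\<open>B\<close> is a voltage lift of a complete bipartite graph. The 6-cycle projects
  to six different vertices there, translating its levels gives the hexagons, and opposite vertices
  lie on different sides, so completeness yields the chords.\<close>

lemma six_cycle_hexagon:
  assumes B: "is_lifting N (all_one_mat n\<^sub>c n\<^sub>v) B"
    and p: "is_cycle (tanner_graph B) p" "length p = 6"
    and no4: "\<And>q. is_cycle (tanner_graph B) q \<Longrightarrow> length q \<noteq> 4"
  shows "(\<exists>q. is_cycle (tanner_graph B) q \<and> length q = 14) \<and>
    (\<exists>q. is_cycle (tanner_graph B) q \<and> length q \<in> {8, 16})"
proof -
  let ?K = "tanner_graph (all_one_mat n\<^sub>c n\<^sub>v)" and ?G = "tanner_graph B"
  obtain s where H: "voltage_lift N s (all_one_mat n\<^sub>c n\<^sub>v) B"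
    using voltage_lift_if_is_lifting[OF B] by blast
  have N: "0 < N" using H by (simp add: voltage_lift_def)
  define x where "x i = proj N (p ! i)" for i
  define f where "f i k = at_level N (x i) (level (p ! i) + k)" for i k
  have K: "{a, b} \<in> snd ?K \<longleftrightarrow> a \<in> fst ?K \<and> b \<in> fst ?K \<and> (isl a \<longleftrightarrow> \<not> isl b)" for a b
    unfolding tanner_edge_iff by (cases a; cases b) (auto simp: tanner_graph_def all_one_mat_def)
  have xK: "x i \<in> fst ?K" if "i < 6" for i
    using p that unfolding x_def by (auto simp: is_cycle_def simp flip: voltage_lift_vertex_iff[OF H])
  have edge: "{p ! i, p ! (Suc i mod 6)} \<in> snd ?G" if "i < 6" for i
    using p that by (simp add: is_cycle_def)
  then have col: "isl (x (Suc i mod 6)) \<longleftrightarrow> \<not> isl (x i)" if "i < 6" for i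
    using that unfolding x_def voltage_lift_edge_iff[OF H] K by blast
  have hex: "{f i k, f (Suc i mod 6) k} \<in> snd ?G" if "i < 6" for i k
  proof -
    have "{x i, x (Suc i mod 6)} \<in> snd ?K"
      "int N dvd level (p ! (Suc i mod 6)) - level (p ! i) - voltage s (x i) (x (Suc i mod 6))"
      using edge[OF that] unfolding voltage_lift_edge_iff[OF H] x_def by auto
    then show ?thesis unfolding f_def
      by (intro voltage_lift_at_level_edge[OF H]) (simp_all add: algebra_simps)
  qed
  \<comment> \<open>The shift of a chord is what remains when its voltage is compared with the
    levels of its ends on the given 6-cycle.\<close>
  have chord: "{f i k, f j (k + (level (p ! i) + voltage s (x i) (x j) - level (p ! j)))} \<in> snd ?G"
    if "i < 6" "j < 6" "isl (x i) \<longleftrightarrow> \<not> isl (x j)" for i j k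
    unfolding f_def using that xK by (intro voltage_lift_at_level_edge[OF H]) (auto simp: K)
  have two: "x (Suc (Suc i mod 6) mod 6) \<noteq> x i" if "i < 6" for i
  proof
    assume eq: "x (Suc (Suc i mod 6) mod 6) = x i"
    have "{p ! (Suc i mod 6), p ! i} \<in> snd ?G"
      "{p ! (Suc i mod 6), p ! (Suc (Suc i mod 6) mod 6)} \<in> snd ?G"
      using edge[OF that] edge[of "Suc i mod 6"] by (simp_all add: insert_commute)
    then have "p ! (Suc (Suc i mod 6) mod 6) = p ! i"
      using voltage_lift_neighbor_unique[OF H] eq by (simp add: x_def)
    then show False using is_cycle_step_back[OF p(1), of i] p(2) that by simp
  qed
  have parity: "isl (x i) \<longleftrightarrow> (isl (x 0) \<longleftrightarrow> even i)" if "i < 6" for i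
    using that
  proof (induction i)
    case (Suc i)
    then show ?case using col[of i] by auto
  qed simp
  \<comment> \<open>Indices of different parity lie on different sides. Those of equal parity are
    two steps apart in one of the two directions around the 6-cycle.\<close>
  have ne: "x i \<noteq> x j" if "i < j" "j < 6" for i j
  proof (cases "even i = even j")
    case True
    then have "j = i + 2 \<or> j = i + 4" using that by presburger
    moreover have "x ((i + 2) mod 6) \<noteq> x i" "x ((j + 2) mod 6) \<noteq> x j"
      using two[of i] two[of j] that by (simp_all add: mod_Suc_eq)
    ultimately show ?thesis using that by auto
  next
    case False
    then show ?thesis using parity[of i] parity[of j] that by auto
  qed
  have "isl (x 0) \<longleftrightarrow> \<not> isl (x 3)" "isl (x 2) \<longleftrightarrow> \<not> isl (x 5)"
    using parity[of 2] parity[of 3] parity[of 5] by auto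
  then have chords:
    "{f 0 k, f 3 (k + (level (p ! 0) + voltage s (x 0) (x 3) - level (p ! 3)))} \<in> snd ?G"
    "{f 2 k, f 5 (k + (level (p ! 2) + voltage s (x 2) (x 5) - level (p ! 5)))} \<in> snd ?G" for k
    by (simp_all add: chord)
  have inj: "f i k = f i l \<longleftrightarrow> int N dvd k - l" for i k l
    by (simp add: f_def at_level_eq_iff[OF N])
  have vert: "f i k \<in> fst ?G" if "i < 6" for i k
    using that xK by (simp add: f_def voltage_lift_vertex_iff[OF H] proj_at_level[OF N])
  have disj: "f i k \<noteq> f j l" if "i < 6" "j < 6" "i \<noteq> j" for i j k l
  proof -
    have "x i \<noteq> x j" using ne that by (metis nat_neq_iff)
    then show ?thesis by (simp add: f_def at_level_eq_iff[OF N])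
  qed
  show ?thesis
    using hexagon_cycles[where f = f, OF inj vert disj hex chords no4] by blast
qed

theorem theorem54:
  fixes n\<^sub>c n\<^sub>v N\<^sub>1 :: nat and B :: "bit mat"
  assumes "is_lifting N\<^sub>1 (all_one_mat n\<^sub>c n\<^sub>v) B"
    and "regular_mat n\<^sub>c n\<^sub>v B"
    and "mat_girth B = 6"
  shows "\<forall>g \<in> {14, 16, 18 :: nat}. \<exists>N H.
    is_lifting N B H \<and> quasi_cyclic N H \<and> mat_girth H = enat g"
proof -
  let ?G = "tanner_graph B"
  have girth: "(INF q\<in>{q. is_cycle ?G q}. enat (length q)) = enat 6"
    using assms(3) by (simp add: mat_girth_def graph_girth_def numeral_eq_enat)
  have ge6: "6 \<le> length q" if "is_cycle ?G q" for q
    using INF_lower[of q "{q. is_cycle ?G q}" "\<lambda>q. enat (length q)"] that unfolding girth by simp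
  obtain p where p: "is_cycle ?G p" "length p = 6"
  proof -
    \<comment> \<open>An infimum below 7 forces a member below 7, and \<open>ge6\<close> then makes
      its length exactly 6.\<close>
    have "\<exists>q. is_cycle ?G q \<and> length q < 7"
      using girth Inf_less_iff[of "(\<lambda>q. enat (length q)) ` {q. is_cycle ?G q}" "enat 7"] by auto
    then obtain q where "is_cycle ?G q" "length q < 7" by blast
    then show thesis using ge6[of q] that[of q] by simp
  qed
  have no4: "length q \<noteq> 4" if "is_cycle ?G q" for q using ge6[OF that] by simp
  have lift: "\<exists>N H. is_lifting N B H \<and> quasi_cyclic N H \<and> mat_girth H = enat (m * length D)"
    if "is_cycle ?G D" "0 < m" "m * length D \<le> 18" for D m
    using lifting_of_prescribed_girth[OF no4 that] is_lifting_quasi_cyclic by blast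
  obtain D\<^sub>1 D\<^sub>2 where D: "is_cycle ?G D\<^sub>1" "length D\<^sub>1 = 14" "is_cycle ?G D\<^sub>2" "length D\<^sub>2 \<in> {8, 16}"
    using six_cycle_hexagon[OF assms(1) p no4] by blast
  have 14: "\<exists>N H. is_lifting N B H \<and> quasi_cyclic N H \<and> mat_girth H = enat 14"
    using lift[OF D(1), of 1] D(2) by simp
  \<comment> \<open>Either the 16-cycle is lifted with \<open>m = 1\<close> or the 8-cycle with
    \<open>m = 2\<close>.\<close>
  have 16: "\<exists>N H. is_lifting N B H \<and> quasi_cyclic N H \<and> mat_girth H = enat 16"
    using lift[OF D(3), of 1] lift[OF D(3), of 2] D(4) by auto
  have 18: "\<exists>N H. is_lifting N B H \<and> quasi_cyclic N H \<and> mat_girth H = enat 18"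
    using lift[OF p(1), of 3] p(2) by simp
  show ?thesis using 14 16 18 by blast
qed

end
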